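(* Let $k\ge2$, let $\beta_1,\dots,\beta_r\in\mathbb R$, let $\mathbf H_s=(H_s,\sigma_s)$, $s=1,\dots,r$, be finite simple $k$-colored graphs, and let $\mathcal F(\mathbf W)=\sum_{s=1}^r\beta_st(\mathbf H_s,\mathbf W)-\frac12\mathcal I(\mathbf W)$. Let $\widetilde{\mathbf W}\in\widetilde{\mathcal W}_k$ be a maximizer of $\mathcal F$ over $\widetilde{\mathcal W}_k$ and let $\mathbf W=(W_1,\dots,W_k)\in\mathcal W_k$ be any representative of the class $\widetilde{\mathbf W}$. Then for every $a\in\{1,\dots,k\}$ and almost every $(x,y)\in[0,1]^2$, $$W_a(x,y)=\frac{\exp\Big(2\sum_{s=1}^r\beta_s\widehat\Delta^{(a)}_{\mathbf H_s}(\mathbf W)(x,y)\Big)}{\sum_{b=1}^k\exp\Big(2\sum_{s=1}^r\beta_s\widehat\Delta^{(b)}_{\mathbf H_s}(\mathbf W)(x,y)\Big)}.$$ Moreover, there exists $\varepsilon>0$ such that $\varepsilon\le W_a(x,y)\le1-\varepsilon$ for all $a\in\{1,\dots,k\}$ and almost every $(x,y)\in[0,1]^2$.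
   Context: Let $[k]=\{1,\dots,k\}$ and $\Delta_k=\{\mu\in[0,1]^k:\sum_a\mu_a=1\}$. A $k$-colored probability graphon is a measurable symmetric map $\mathbf W=(W_1,\dots,W_k):[0,1]^2\to\Delta_k$; $\mathcal W_k$ is the set of these. For bounded measurable $U:[0,1]^2\to\mathbb R$, $\|U\|_\square=\sup_{S,T\subset[0,1]}|\int_{S\times T}U|$; for vector-valued $\mathbf U$, $\|\mathbf U\|_\square=\sum_a\|U_a\|_\square$. $\delta_\square(\mathbf U,\mathbf W)=\inf_\phi\|\mathbf U-\mathbf W^\phi\|_\square$ over measure-preserving bijections $\phi$ of $[0,1]$, $\mathbf W^\phi(x,y)=\mathbf W(\phi(x),\phi(y))$. $\widetilde{\mathcal W}_k$ is the quotient of $\mathcal W_k$ by $\delta_\square=0$. A $k$-colored graph $\mathbf H=(H,\sigma)$ is a finite simple graph with $\sigma:E(H)\to[k]$, and $$t(\mathbf H,\mathbf W)=\int_{[0,1]^{V(H)}}\prod_{(u,v)\in E(H)}W_{\sigma((u,v))}(x_u,x_v)\prod_{v\in V(H)}dx_v .$$ $\mathcal I(\mathbf W)=\sum_{a=1}^k\int_{[0,1]^2}W_a\log W_a\,dx\,dy$, $0\log0=0$. Both $t(\mathbf H,\cdot)$ and $\mathcal I$ depend only on the class in $\widetilde{\mathcal W}_k$, so $\mathcal F$ is a functional on $\widetilde{\mathcal W}_k$. With each edge of $H$ written once as an ordered pair $(u,v)$ (a fixed orientation), define for $a\in[k]$ $$\Delta^{(a)}_{\mathbf H}(\mathbf W)(x,y)=\sum_{(u,v)\in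 E(H)}\mathbf 1\{\sigma((u,v))=a\}\int_{[0,1]^{|V(H)|-2}}\prod_{(u',v')\in E(H),\,(u',v')\ne(u,v)}W_{\sigma((u',v'))}(x_{u'},x_{v'})\prod_{t\in V(H)\setminus\{u,v\}}dx_t,$$ where in the summand of $(u,v)$ one sets $x_u=x$, $x_v=y$; and $$\widehat\Delta^{(a)}_{\mathbf H}(\mathbf W)(x,y)=\tfrac12\big[\Delta^{(a)}_{\mathbf H}(\mathbf W)(x,y)+\Delta^{(a)}_{\mathbf H}(\mathbf W)(y,x)\big].$$ *)

theory Defs
  imports "HOL-Analysis.Analysis"
begin

text \<open>
  Measurability is Borel measurability throughout. Functions on \<open>[0,1]\<^sup>2\<close> are represented by
  functions on \<open>real \<times> real\<close> whose values outside the square are irrelevant; a tuple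
  \<open>(W\<^sub>1, \<dots>, W\<^sub>k)\<close> is represented by a function on \<open>nat\<close>, of which only the
  values at \<open>1, \<dots>, k\<close> matter.
\<close>

definition unit_interval :: "real measure" where
  "unit_interval = restrict_space lborel {0..1}"

definition unit_square :: "(real \<times> real) measure" where
  "unit_square = unit_interval \<Otimes>\<^sub>M unit_interval"

definition graphons :: "nat \<Rightarrow> (nat \<Rightarrow> real \<times> real \<Rightarrow> real) set" where
  "graphons k = {W.
     (\<forall>a\<in>{1..k}. W a \<in> borel_measurable unit_square) \<and>
     (\<forall>a\<in>{1..k}. \<forall>x\<in>{0..1}. \<forall>y\<in>{0..1}. W a (x, y) = W a (y, x)) \<and>
     (\<forall>x\<in>{0..1}. \<forall>y\<in>{0..1}.
        (\<forall>a\<in>{1..k}. W a (x, y) \<in> {0..1}) \<and> (\<Sum>a=1..k. W a (x, y)) = 1)}"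

definition cut_norm :: "(real \<times> real \<Rightarrow> real) \<Rightarrow> real" where
  "cut_norm U =
     (SUP (S, T) \<in> sets unit_interval \<times> sets unit_interval. \<bar>LINT z:S \<times> T|unit_square. U z\<bar>)"

definition mp_bijections :: "(real \<Rightarrow> real) set" where
  "mp_bijections = {\<phi>. \<phi> \<in> unit_interval \<rightarrow>\<^sub>M unit_interval \<and> bij_betw \<phi> {0..1} {0..1} \<and>
     distr unit_interval unit_interval \<phi> = unit_interval}"

definition cut_distance ::
  "nat \<Rightarrow> (nat \<Rightarrow> real \<times> real \<Rightarrow> real) \<Rightarrow> (nat \<Rightarrow> real \<times> real \<Rightarrow> real) \<Rightarrow> real" where
  "cut_distance k U W =
     (INF \<phi>\<in>mp_bijections. \<Sum>a=1..k. cut_norm (\<lambda>(x, y). U a (x, y) - W a (\<phi> x, \<phi> y)))"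

definition graphon_classes :: "nat \<Rightarrow> (nat \<Rightarrow> real \<times> real \<Rightarrow> real) set set" where
  "graphon_classes k =
     graphons k // {(U, W). U \<in> graphons k \<and> W \<in> graphons k \<and> cut_distance k U W = 0}"

text \<open>
  An edge \<open>{u, v}\<close> of a simple graph is stored as exactly one of the pairs \<open>(u, v)\<close>, \<open>(v, u)\<close>,
  so that \<open>edges\<close> carries the fixed orientation.
\<close>

record 'v colored_graph =
  verts :: "'v set"
  edges :: "('v \<times> 'v) set"
  color :: "'v \<times> 'v \<Rightarrow> nat"

definition simple_colored_graph :: "nat \<Rightarrow> 'v colored_graph \<Rightarrow> bool" where
  "simple_colored_graph k H \<longleftrightarrow>
     finite (verts H) \<and> edges H \<subseteq> verts H \<times> verts H \<and>
     (\<forall>u v. (u, v) \<in> edges H \<longrightarrow> u \<noteq> v \<and> (v, u) \<notin> edges H) \<and>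
     (\<forall>e\<in>edges H. color H e \<in> {1..k})"

definition hom_density :: "'v colored_graph \<Rightarrow> (nat \<Rightarrow> real \<times> real \<Rightarrow> real) \<Rightarrow> real" where
  "hom_density H W =
     (\<integral>p. (\<Prod>(u, v)\<in>edges H. W (color H (u, v)) (p u, p v)) \<partial>(\<Pi>\<^sub>M v\<in>verts H. unit_interval))"

text \<open>The convention \<open>0 log 0 = 0\<close> is automatic because of the factor \<open>W a z\<close>.\<close>

definition entropy_functional :: "nat \<Rightarrow> (nat \<Rightarrow> real \<times> real \<Rightarrow> real) \<Rightarrow> real" where
  "entropy_functional k W = (\<Sum>a=1..k. \<integral>z. W a z * ln (W a z) \<partial>unit_square)"

definition free_energy ::
  "nat \<Rightarrow> nat \<Rightarrow> (nat \<Rightarrow> real) \<Rightarrow> (nat \<Rightarrow> 'v colored_graph) \<Rightarrow>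
     (nat \<Rightarrow> real \<times> real \<Rightarrow> real) \<Rightarrow> real" where
  "free_energy k r \<beta> H W =
     (\<Sum>s=1..r. \<beta> s * hom_density (H s) W) - 1 / 2 * entropy_functional k W"

text \<open>
  The functional induced on classes. It takes the common value on all representatives;
  \<open>free_energy\<close> is constant on every element of \<open>graphon_classes k\<close>, so \<open>the_elem\<close> is applied
  to a singleton.
\<close>

definition free_energy_class ::
  "nat \<Rightarrow> nat \<Rightarrow> (nat \<Rightarrow> real) \<Rightarrow> (nat \<Rightarrow> 'v colored_graph) \<Rightarrow>
     (nat \<Rightarrow> real \<times> real \<Rightarrow> real) set \<Rightarrow> real" where
  "free_energy_class k r \<beta> H C = the_elem (free_energy k r \<beta> H ` C)"

definition edge_delta ::
  "'v colored_graph \<Rightarrow> nat \<Rightarrow> (nat \<Rightarrow> real \<times> real \<Rightarrow> real) \<Rightarrow> real \<times> real \<Rightarrow> real" where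
  "edge_delta H a W = (\<lambda>(x, y). \<Sum>(u, v)\<in>edges H. of_bool (color H (u, v) = a) *
     (\<integral>p. (let q = p(u := x, v := y) in
           \<Prod>(u', v')\<in>edges H - {(u, v)}. W (color H (u', v')) (q u', q v'))
        \<partial>(\<Pi>\<^sub>M t\<in>verts H - {u, v}. unit_interval)))"

definition sym_edge_delta ::
  "'v colored_graph \<Rightarrow> nat \<Rightarrow> (nat \<Rightarrow> real \<times> real \<Rightarrow> real) \<Rightarrow> real \<times> real \<Rightarrow> real" where
  "sym_edge_delta H a W = (\<lambda>(x, y). 1 / 2 * (edge_delta H a W (x, y) + edge_delta H a W (y, x)))"

end

theory Submission
  imports Defs "HOL-Probability.Probability"
begin

text \<open>
  Weakly isomorphic graphons have the same free energy. For the densities this is the counting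
  lemma. For the entropy one uses the duality \<open>x ln x = max\<^sub>s (s x - exp (s - 1))\<close>: testing with a
  bounded \<open>s\<close>, transported along the rearrangement, passes to cut norm limits. This needs no
  inverse of the rearranging maps, so both inequalities follow from one sequence of maps.

  Let \<open>p\<close> be the Gibbs density on the right-hand side of the equation. Moving from \<open>W\<close> towards
  \<open>p\<close>, the entropy is only estimated by convexity, while the densities are polynomial
  in the step size; maximality thus yields a linear inequality between the entropies of \<open>W\<close> and
  \<open>p\<close>, which says that the integrated relative entropy of \<open>W\<close> with respect to \<open>p\<close> is at
  most \<open>0\<close>. Hence \<open>W = p\<close> almost everywhere, and the bounds on \<open>W\<close> are those of
  \<open>p\<close>. In particular \<open>W\<close> need not be known in advance to stay away from \<open>0\<close>.
\<close>

section \<open>Cut norm and weak convergence\<close>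

text \<open>Cut norm convergence permits oscillation, and under it integrals of
  \<open>x ln x\<close> are only lower semicontinuous; so constancy of the entropy on a class has to
  come from two semicontinuity inequalities, not from continuity. Moreover the infimum in the cut
  distance need not be attained: distance zero yields a sequence of rearrangements without a limit
  map, and a fixed test function must be carried along by it. Constancy matters because the
  maximizer is a class, and \<open>the_elem\<close> returns the value of a representative only if
  the image is a singleton.

  The Gibbs density arises from linearising the densities alone: with the kernels frozen at
  \<open>W\<close>, the remaining problem, linear term minus half the entropy, is solved pointwise.
  Linearising the entropy as well would meet the infinite slope of \<open>x ln x\<close> at 0; its
  chord from \<open>W\<close> to \<open>p\<close> has no such problem. The factor 2 in the exponent
  inverts the \<open>1 / 2\<close> in front of the entropy, and the kernels appear symmetrised
  because admissible directions are symmetric.\<close>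

lemma space_unit_interval: "space unit_interval = {0..1}"
  by (simp add: unit_interval_def space_restrict_space)

lemma space_unit_square: "space unit_square = {0..1} \<times> {0..1}"
  by (simp add: unit_square_def space_pair_measure space_unit_interval)

interpretation unit_interval: prob_space unit_interval
proof
  show "emeasure unit_interval (space unit_interval) = 1"
    unfolding unit_interval_def by (simp add: space_restrict_space emeasure_restrict_space)
qed

interpretation unit_interval_pair: pair_prob_space unit_interval unit_interval ..

interpretation unit_square: prob_space unit_square
  unfolding unit_square_def by (rule unit_interval_pair.prob_space_axioms)

lemma (in finite_measure) integrable_bounded:
  fixes f :: "'a \<Rightarrow> real"
  assumes "f \<in> borel_measurable M" and "\<And>x. x \<in> space M \<Longrightarrow> \<bar>f x\<bar> \<le> B"
  shows "integrable M f"
  using assms by (intro integrable_const_bound[of _ B]) auto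

lemma (in finite_measure) integrable_indicat_real:
  "A \<in> sets M \<Longrightarrow> integrable M (indicat_real A)"
  by (rule integrable_bounded[where B = 1]) (auto simp: indicator_def)

lemma integrable_product_weight:
  fixes f g :: "real \<Rightarrow> real"
  assumes "integrable unit_square U"
    and f: "f \<in> borel_measurable unit_interval" "\<And>x. x \<in> {0..1} \<Longrightarrow> f x \<in> {0..1}"
    and g: "g \<in> borel_measurable unit_interval" "\<And>x. x \<in> {0..1} \<Longrightarrow> g x \<in> {0..1}"
  shows "integrable unit_square (\<lambda>z. f (fst z) * g (snd z) * U z)"
proof (rule Bochner_Integration.integrable_bound[OF assms(1)])
  have [measurable]: "U \<in> borel_measurable (unit_interval \<Otimes>\<^sub>M unit_interval)"
    using assms(1) unfolding unit_square_def by auto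
  note f(1)[measurable] g(1)[measurable]
  show "(\<lambda>z. f (fst z) * g (snd z) * U z) \<in> borel_measurable unit_square"
    unfolding unit_square_def by measurable
  show "AE z in unit_square. norm (f (fst z) * g (snd z) * U z) \<le> norm (U z)"
  proof (intro AE_I2)
    fix z assume "z \<in> space unit_square"
    hence "fst z \<in> {0..1}" "snd z \<in> {0..1}" by (auto simp: space_unit_square)
    hence "f (fst z) \<in> {0..1}" "g (snd z) \<in> {0..1}" using f(2)[of "fst z"] g(2)[of "snd z"] by (blast+)
    hence "0 \<le> f (fst z) * g (snd z)" "f (fst z) * g (snd z) \<le> 1"
      by (auto intro: mult_le_one)
    hence "\<bar>f (fst z) * g (snd z)\<bar> \<le> 1" by linarith
    hence "\<bar>f (fst z) * g (snd z)\<bar> * \<bar>U z\<bar> \<le> 1 * \<bar>U z\<bar>"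
      by (intro mult_right_mono) auto
    thus "norm (f (fst z) * g (snd z) * U z) \<le> norm (U z)"
      by (simp only: abs_mult real_norm_def mult_1)
  qed
qed

text \<open>Fubini in both orders: the weight \<open>f\<close> will be optimised with
  \<open>g\<close> frozen, and \<open>g\<close> with \<open>f\<close> frozen, and each time the
  other variable has to be integrated out first.\<close>

lemma integral_product_weight:
  fixes f g :: "real \<Rightarrow> real"
  assumes "integrable unit_square U"
    and f: "f \<in> borel_measurable unit_interval" "\<And>x. x \<in> {0..1} \<Longrightarrow> f x \<in> {0..1}"
    and g: "g \<in> borel_measurable unit_interval" "\<And>x. x \<in> {0..1} \<Longrightarrow> g x \<in> {0..1}"
  shows "(\<integral>z. f (fst z) * g (snd z) * U z \<partial>unit_square) =
           (\<integral>x. f x * (\<integral>y. g y * U (x, y) \<partial>unit_interval) \<partial>unit_interval)" (is ?A)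
    and "(\<integral>z. f (fst z) * g (snd z) * U z \<partial>unit_square) =
           (\<integral>y. g y * (\<integral>x. f x * U (x, y) \<partial>unit_interval) \<partial>unit_interval)" (is ?B)
    and "integrable unit_interval (\<lambda>x. f x * (\<integral>y. g y * U (x, y) \<partial>unit_interval))" (is ?C)
    and "integrable unit_interval (\<lambda>y. g y * (\<integral>x. f x * U (x, y) \<partial>unit_interval))" (is ?D)
proof -
  note int = integrable_product_weight[OF assms, unfolded unit_square_def]
  have int': "integrable (unit_interval \<Otimes>\<^sub>M unit_interval) (\<lambda>(x, y). f x * g y * U (x, y))"
    using int by (simp add: case_prod_unfold)
  have comm: "f x * g y * u = g y * (f x * u)" for x y u by simp
  show ?A
    using unit_interval_pair.integral_fst'[OF int]
    by (simp add: unit_square_def mult.assoc)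
  show ?B
    using unit_interval_pair.integral_snd[OF int']
    by (simp add: unit_square_def case_prod_unfold comm)
  show ?C
    using unit_interval_pair.integrable_fst'[OF int] by (simp add: mult.assoc)
  show ?D
    using unit_interval_pair.integrable_snd[OF int']
    by (simp add: comm)
qed

lemma measurable_marginals:
  fixes f g :: "real \<Rightarrow> real"
  assumes [measurable]: "U \<in> borel_measurable unit_square"
    "f \<in> borel_measurable unit_interval"
  shows "(\<lambda>x. \<integral>y. f y * U (x, y) \<partial>unit_interval) \<in> borel_measurable unit_interval"
    and "(\<lambda>y. \<integral>x. f x * U (x, y) \<partial>unit_interval) \<in> borel_measurable unit_interval"
proof -
  have [measurable]: "U \<in> borel_measurable (unit_interval \<Otimes>\<^sub>M unit_interval)"
    using assms(1) unfolding unit_square_def .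
  show "(\<lambda>x. \<integral>y. f y * U (x, y) \<partial>unit_interval) \<in> borel_measurable unit_interval"
    by measurable
  show "(\<lambda>y. \<integral>x. f x * U (x, y) \<partial>unit_interval) \<in> borel_measurable unit_interval"
    by measurable
qed

text \<open>A real \<open>SUP\<close> says something only for a bounded set; the L1 norm of
  \<open>U\<close> bounds every rectangle.\<close>

lemma bdd_above_cut_norm:
  fixes U :: "real \<times> real \<Rightarrow> real"
  assumes "integrable unit_square U"
  shows "bdd_above ((\<lambda>(S, T). \<bar>LINT z:S \<times> T|unit_square. U z\<bar>) `
    (sets unit_interval \<times> sets unit_interval))"
proof (rule bdd_aboveI2, clarify)
  fix S T assume "S \<in> sets unit_interval" "T \<in> sets unit_interval"
  hence ST: "S \<times> T \<in> sets unit_square" by (simp add: unit_square_def)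
  have "\<bar>LINT z:S \<times> T|unit_square. U z\<bar> \<le> (\<integral>z. \<bar>indicator (S \<times> T) z *\<^sub>R U z\<bar> \<partial>unit_square)"
    unfolding set_lebesgue_integral_def
    using integral_norm_bound[of unit_square "\<lambda>z. indicator (S \<times> T) z *\<^sub>R U z"] by simp
  also have "\<dots> \<le> (\<integral>z. \<bar>U z\<bar> \<partial>unit_square)"
    using assms ST
    by (intro integral_mono integrable_abs integrable_mult_indicator) (auto simp: indicator_def)
  finally show "\<bar>LINT z:S \<times> T|unit_square. U z\<bar> \<le> (\<integral>z. \<bar>U z\<bar> \<partial>unit_square)" .
qed

lemma rectangle_le_cut_norm:
  assumes "integrable unit_square U" "S \<in> sets unit_interval" "T \<in> sets unit_interval"
  shows "\<bar>LINT z:S \<times> T|unit_square. U z\<bar> \<le> cut_norm U"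
  unfolding cut_norm_def
  using cSUP_upper[OF _ bdd_above_cut_norm[OF assms(1)], of "(S, T)"] assms(2,3) by simp

lemma cut_norm_nonneg:
  assumes "integrable unit_square U"
  shows "0 \<le> cut_norm U"
  using rectangle_le_cut_norm[OF assms, of "{}" "{}"] by auto

text \<open>Replacing \<open>f\<close>, then \<open>g\<close>, by the indicator of the set where its cofactor is positive
  only increases the integral.\<close>

lemma product_weight_le_rectangle:
  fixes f g :: "real \<Rightarrow> real"
  assumes U: "integrable unit_square U"
    and f: "f \<in> borel_measurable unit_interval" "\<And>x. x \<in> {0..1} \<Longrightarrow> f x \<in> {0..1}"
    and g: "g \<in> borel_measurable unit_interval" "\<And>x. x \<in> {0..1} \<Longrightarrow> g x \<in> {0..1}"
  obtains S T where "S \<in> sets unit_interval" "T \<in> sets unit_interval"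
    "(\<integral>z. f (fst z) * g (snd z) * U z \<partial>unit_square) \<le> (LINT z:S \<times> T|unit_square. U z)"
proof -
  note borel_measurable_integrable[OF U, measurable] f(1)[measurable] g(1)[measurable]
  define h where "h x = (\<integral>y. g y * U (x, y) \<partial>unit_interval)" for x
  have h[measurable]: "h \<in> borel_measurable unit_interval"
    unfolding h_def by (rule measurable_marginals) auto
  define S where "S = {x \<in> space unit_interval. h x > 0}"
  have S[measurable]: "S \<in> sets unit_interval" unfolding S_def by measurable
  \<comment> \<open>The cofactor of \<open>g\<close> is formed with the indicator of
    \<open>S\<close>, which has already replaced \<open>f\<close>.\<close>
  define k where "k y = (\<integral>x. indicator S x * U (x, y) \<partial>unit_interval)" for y
  have k[measurable]: "k \<in> borel_measurable unit_interval"
    unfolding k_def by (rule measurable_marginals) auto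
  define T where "T = {y \<in> space unit_interval. k y > 0}"
  have T[measurable]: "T \<in> sets unit_interval" unfolding T_def by measurable
  have indS: "indicator S \<in> borel_measurable unit_interval" "\<And>x. indicat_real S x \<in> {0..1}"
    and indT: "indicator T \<in> borel_measurable unit_interval" "\<And>x. indicat_real T x \<in> {0..1}"
    by (auto simp: indicator_def)
  note fg = integral_product_weight[OF U f g, folded h_def]
  note Sg = integral_product_weight[OF U indS g, folded h_def k_def]
  note ST = integral_product_weight[OF U indS indT, folded k_def]
  have "(\<integral>z. f (fst z) * g (snd z) * U z \<partial>unit_square) = (\<integral>x. f x * h x \<partial>unit_interval)"
    by (rule fg(1))
  also have "\<dots> \<le> (\<integral>x. indicator S x * h x \<partial>unit_interval)"
  proof (rule integral_mono[OF fg(3) Sg(3)])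
    fix x assume x: "x \<in> space unit_interval"
    show "f x * h x \<le> indicator S x * h x"
      using f(2)[of x] x
      by (cases "h x > 0")
        (auto simp: S_def space_unit_interval mult_left_le_one_le mult_nonneg_nonpos)
  qed
  also have "\<dots> = (\<integral>y. g y * k y \<partial>unit_interval)"
    using Sg(1,2) by simp
  also have "\<dots> \<le> (\<integral>y. indicator T y * k y \<partial>unit_interval)"
  proof (rule integral_mono[OF Sg(4) ST(4)])
    fix y assume y: "y \<in> space unit_interval"
    show "g y * k y \<le> indicator T y * k y"
      using g(2)[of y] y
      by (cases "k y > 0")
        (auto simp: T_def space_unit_interval mult_left_le_one_le mult_nonneg_nonpos)
  qed
  also have "\<dots> = (LINT z:S \<times> T|unit_square. U z)"
    unfolding ST(2)[symmetric] set_lebesgue_integral_def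
    by (intro Bochner_Integration.integral_cong) (auto simp: indicator_def)
  finally show thesis using that[OF S T] by blast
qed

text \<open>The rectangle that dominates the integral from above and the one that dominates its
  negative may differ, hence the separate application to \<open>- U\<close>.\<close>

lemma product_weight_le_cut_norm:
  fixes f g :: "real \<Rightarrow> real"
  assumes U: "integrable unit_square U"
    and f: "f \<in> borel_measurable unit_interval" "\<And>x. x \<in> {0..1} \<Longrightarrow> f x \<in> {0..1}"
    and g: "g \<in> borel_measurable unit_interval" "\<And>x. x \<in> {0..1} \<Longrightarrow> g x \<in> {0..1}"
  shows "\<bar>\<integral>z. f (fst z) * g (snd z) * U z \<partial>unit_square\<bar> \<le> cut_norm U"
proof (rule abs_leI)
  obtain S T where "S \<in> sets unit_interval" "T \<in> sets unit_interval"
    "(\<integral>z. f (fst z) * g (snd z) * U z \<partial>unit_square) \<le> (LINT z:S \<times> T|unit_square. U z)"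
    using product_weight_le_rectangle[OF U f g] .
  thus "(\<integral>z. f (fst z) * g (snd z) * U z \<partial>unit_square) \<le> cut_norm U"
    using rectangle_le_cut_norm[OF U, of S T] by linarith
  have "integrable unit_square (\<lambda>z. - U z)" using U by simp
  then obtain S T where "S \<in> sets unit_interval" "T \<in> sets unit_interval"
    "(\<integral>z. f (fst z) * g (snd z) * - U z \<partial>unit_square) \<le> (LINT z:S \<times> T|unit_square. - U z)"
    using product_weight_le_rectangle f g by blast
  thus "- (\<integral>z. f (fst z) * g (snd z) * U z \<partial>unit_square) \<le> cut_norm U"
    using rectangle_le_cut_norm[OF U, of S T] by (simp add: set_lebesgue_integral_def)
qed

section \<open>Change of variables, and weak convergence along rearrangements\<close>

definition measure_preserving :: "(real \<Rightarrow> real) \<Rightarrow> bool" where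
  "measure_preserving \<phi> \<longleftrightarrow> \<phi> \<in> unit_interval \<rightarrow>\<^sub>M unit_interval \<and>
     distr unit_interval unit_interval \<phi> = unit_interval"

lemma measurable_map_prod:
  assumes "measure_preserving \<phi>"
  shows "map_prod \<phi> \<phi> \<in> unit_square \<rightarrow>\<^sub>M unit_square"
proof -
  have [measurable]: "\<phi> \<in> unit_interval \<rightarrow>\<^sub>M unit_interval"
    using assms by (simp add: measure_preserving_def)
  have "(\<lambda>(x, y). (\<phi> x, \<phi> y)) \<in> unit_square \<rightarrow>\<^sub>M unit_square"
    unfolding unit_square_def by measurable
  thus ?thesis by (simp add: map_prod_def)
qed

lemma distr_map_prod:
  assumes "measure_preserving \<phi>"
  shows "distr unit_square unit_square (map_prod \<phi> \<phi>) = unit_square"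
proof -
  have \<phi>: "\<phi> \<in> unit_interval \<rightarrow>\<^sub>M unit_interval"
    "distr unit_interval unit_interval \<phi> = unit_interval"
    using assms by (auto simp: measure_preserving_def)
  have "distr unit_interval unit_interval \<phi> \<Otimes>\<^sub>M distr unit_interval unit_interval \<phi> =
      distr unit_square unit_square (\<lambda>(x, y). (\<phi> x, \<phi> y))"
    unfolding unit_square_def using \<phi>
    by (intro pair_measure_distr) (auto intro: unit_interval.sigma_finite_measure_axioms)
  thus ?thesis by (simp add: \<phi>(2) map_prod_def unit_square_def)
qed

lemma
  fixes f :: "real \<times> real \<Rightarrow> real"
  assumes "measure_preserving \<phi>" "f \<in> borel_measurable unit_square"
  shows integral_map_prod: "(\<integral>z. f (map_prod \<phi> \<phi> z) \<partial>unit_square) = (\<integral>z. f z \<partial>unit_square)"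
    and integrable_map_prod:
      "integrable unit_square (\<lambda>z. f (map_prod \<phi> \<phi> z)) \<longleftrightarrow> integrable unit_square f"
  using integral_distr[OF measurable_map_prod[OF assms(1)] assms(2)]
    integrable_distr_eq[OF measurable_map_prod[OF assms(1)] assms(2)]
  by (simp_all add: distr_map_prod[OF assms(1)])

lemma integrable_map_prod_mult:
  fixes g D :: "real \<times> real \<Rightarrow> real"
  assumes "measure_preserving \<phi>" and D: "D \<in> borel_measurable unit_square"
    "\<And>z. z \<in> space unit_square \<Longrightarrow> \<bar>D z\<bar> \<le> 1"
    and g: "integrable unit_square g"
  shows "integrable unit_square (\<lambda>z. g (map_prod \<phi> \<phi> z) * D z)"
proof -
  have comp: "integrable unit_square (\<lambda>z. g (map_prod \<phi> \<phi> z))"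
    using g integrable_map_prod[OF assms(1) borel_measurable_integrable[OF g]] by simp
  note [measurable] = D(1) borel_measurable_integrable[OF comp]
  show ?thesis
  proof (rule Bochner_Integration.integrable_bound[OF comp])
    show "AE z in unit_square. norm (g (map_prod \<phi> \<phi> z) * D z) \<le> norm (g (map_prod \<phi> \<phi> z))"
      by (rule AE_I2) (auto simp: abs_mult intro!: mult_left_le D(2))
  qed measurable
qed

text \<open>Good test functions are closed under dominated limits: as
  \<open>\<bar>D n z\<bar> \<le> 1\<close> and the maps preserve measure, replacing \<open>f\<close>
  by \<open>s i\<close> costs at most the L1 norm of \<open>s i - f\<close>, uniformly in
  \<open>n\<close>. The factor 2 is the one supplied by \<open>integrable_induct\<close>.\<close>

lemma tendsto_integral_dominated_approx:
  fixes s :: "nat \<Rightarrow> real \<times> real \<Rightarrow> real" and \<phi> :: "nat \<Rightarrow> real \<Rightarrow> real"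
  assumes mp: "\<And>n. measure_preserving (\<phi> n)"
    and D: "\<And>n. D n \<in> borel_measurable unit_square"
      "\<And>n z. z \<in> space unit_square \<Longrightarrow> \<bar>D n z\<bar> \<le> 1"
    and s: "\<And>i. integrable unit_square (s i)"
      "\<And>z. z \<in> space unit_square \<Longrightarrow> (\<lambda>i. s i z) \<longlonglongrightarrow> f z"
      "\<And>i z. z \<in> space unit_square \<Longrightarrow> \<bar>s i z\<bar> \<le> 2 * \<bar>f z\<bar>"
    and f: "integrable unit_square f"
    and lim: "\<And>i. (\<lambda>n. \<integral>z. s i (map_prod (\<phi> n) (\<phi> n) z) * D n z \<partial>unit_square) \<longlonglongrightarrow> 0"
  shows "(\<lambda>n. \<integral>z. f (map_prod (\<phi> n) (\<phi> n) z) * D n z \<partial>unit_square) \<longlonglongrightarrow> 0"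
proof (rule tendstoI)
  fix e :: real assume e: "e > 0"
  note D(1)[measurable]
  have comp: "integrable unit_square (\<lambda>z. g (map_prod (\<phi> n) (\<phi> n) z))"
    if "integrable unit_square g" for g :: "real \<times> real \<Rightarrow> real" and n
    using that integrable_map_prod[OF mp borel_measurable_integrable[OF that]] by simp
  have prod: "integrable unit_square (\<lambda>z. g (map_prod (\<phi> n) (\<phi> n) z) * D n z)"
    if "integrable unit_square g" for g :: "real \<times> real \<Rightarrow> real" and n
    by (rule integrable_map_prod_mult[OF mp D that])
  have "(\<lambda>i. \<integral>z. \<bar>s i z - f z\<bar> \<partial>unit_square) \<longlonglongrightarrow> (\<integral>z. 0 \<partial>unit_square)"
  \<comment> \<open>The dominating function is 2 times \<open>\<bar>f z\<bar>\<close> for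
    \<open>s i\<close> plus once for \<open>f\<close>.\<close>
  proof (rule integral_dominated_convergence[where w = "\<lambda>z. 3 * \<bar>f z\<bar>"])
    show "AE z in unit_square. (\<lambda>i. \<bar>s i z - f z\<bar>) \<longlonglongrightarrow> 0"
      using s(2) by (intro AE_I2 tendsto_rabs_zero LIM_zero) auto
    show "AE z in unit_square. norm \<bar>s i z - f z\<bar> \<le> 3 * \<bar>f z\<bar>" for i
      by (rule AE_I2) (use s(3)[of _ i] in fastforce)
  qed (use s(1) f in auto)
  hence "eventually (\<lambda>i. \<bar>\<integral>z. \<bar>s i z - f z\<bar> \<partial>unit_square\<bar> < e / 2) sequentially"
    using e by (auto dest!: tendstoD[where e = "e / 2"] simp: dist_real_def)
  \<comment> \<open>The index \<open>i\<close> is fixed before \<open>n\<close> is sent to infinity;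
    this is where uniformity in \<open>n\<close> is used.\<close>
  then obtain i where i: "\<bar>\<integral>z. \<bar>s i z - f z\<bar> \<partial>unit_square\<bar> < e / 2"
    by (auto simp: eventually_sequentially)
  have "eventually (\<lambda>n. \<bar>\<integral>z. s i (map_prod (\<phi> n) (\<phi> n) z) * D n z \<partial>unit_square\<bar> < e / 2)
      sequentially"
    using e lim[of i] by (auto dest!: tendstoD[where e = "e / 2"] simp: dist_real_def)
  thus "eventually (\<lambda>n. dist (\<integral>z. f (map_prod (\<phi> n) (\<phi> n) z) * D n z \<partial>unit_square) 0 < e)
      sequentially"
  proof eventually_elim
    case (elim n)
    let ?\<Phi> = "map_prod (\<phi> n) (\<phi> n)"
    have "\<bar>(\<integral>z. s i (?\<Phi> z) * D n z \<partial>unit_square) - (\<integral>z. f (?\<Phi> z) * D n z \<partial>unit_square)\<bar>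
        = \<bar>\<integral>z. (s i (?\<Phi> z) - f (?\<Phi> z)) * D n z \<partial>unit_square\<bar>"
      by (simp add: left_diff_distrib prod[OF s(1)] prod[OF f])
    also have "\<dots> \<le> (\<integral>z. \<bar>(s i (?\<Phi> z) - f (?\<Phi> z)) * D n z\<bar> \<partial>unit_square)"
      using integral_norm_bound[of unit_square "\<lambda>z. (s i (?\<Phi> z) - f (?\<Phi> z)) * D n z"]
      by simp
    also have "\<dots> \<le> (\<integral>z. \<bar>s i (?\<Phi> z) - f (?\<Phi> z)\<bar> \<partial>unit_square)"
    proof (rule integral_mono)
      show "integrable unit_square (\<lambda>z. \<bar>(s i (?\<Phi> z) - f (?\<Phi> z)) * D n z\<bar>)"
        using prod[OF s(1)[of i], of n] prod[OF f, of n] by (simp add: left_diff_distrib)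
      show "integrable unit_square (\<lambda>z. \<bar>s i (?\<Phi> z) - f (?\<Phi> z)\<bar>)"
        using comp[OF s(1)[of i], of n] comp[OF f, of n] by simp
    qed (auto simp: abs_mult intro!: mult_left_le D(2))
    also have "\<dots> = (\<integral>z. \<bar>s i z - f z\<bar> \<partial>unit_square)"
      using integral_map_prod[OF mp, of "\<lambda>z. \<bar>s i z - f z\<bar>" n] s(1) f by simp
    finally show ?case using elim i by (simp add: dist_real_def)
  qed
qed

text \<open>A small cut norm controls rectangles only, with no uniform rate over bounded test
  functions. A single \<open>f\<close> can nevertheless be moved by varying maps, because
  \<open>map_prod\<close> pulls rectangles back to rectangles. The pi-lambda argument extends this
  to measurable sets, and approximation by simple functions to integrable \<open>f\<close>.\<close>

lemma tendsto_integral_cut_norm: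
  fixes f :: "real \<times> real \<Rightarrow> real" and \<phi> :: "nat \<Rightarrow> real \<Rightarrow> real"
  assumes mp: "\<And>n. measure_preserving (\<phi> n)"
    and D: "\<And>n. D n \<in> borel_measurable unit_square"
      "\<And>n z. z \<in> space unit_square \<Longrightarrow> \<bar>D n z\<bar> \<le> 1"
    and cut: "(\<lambda>n. cut_norm (D n)) \<longlonglongrightarrow> 0"
    and f: "integrable unit_square f"
  shows "(\<lambda>n. \<integral>z. f (map_prod (\<phi> n) (\<phi> n) z) * D n z \<partial>unit_square) \<longlonglongrightarrow> 0"
proof -
  note D(1)[measurable]
  have intD: "integrable unit_square (D n)" for n
    using D by (intro unit_square.integrable_bounded[where B = 1])
  have prod: "integrable unit_square (\<lambda>z. g (map_prod (\<phi> n) (\<phi> n) z) * D n z)"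
    if "integrable unit_square g" for g :: "real \<times> real \<Rightarrow> real" and n
    by (rule integrable_map_prod_mult[OF mp D that])
  define P :: "(real \<times> real \<Rightarrow> real) \<Rightarrow> bool" where
    "P = (\<lambda>g. (\<lambda>n. \<integral>z. g (map_prod (\<phi> n) (\<phi> n) z) * D n z \<partial>unit_square) \<longlonglongrightarrow> 0)"
  have rectangle: "P (indicator (S \<times> T))"
    if ST: "S \<in> sets unit_interval" "T \<in> sets unit_interval" for S T
    unfolding P_def
  proof (rule Lim_null_comparison[OF always_eventually cut], rule allI)
    fix n
    let ?S = "\<phi> n -` S \<inter> space unit_interval" and ?T = "\<phi> n -` T \<inter> space unit_interval"
    have [measurable]: "\<phi> n \<in> unit_interval \<rightarrow>\<^sub>M unit_interval"
      using mp by (simp add: measure_preserving_def)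
    have m: "?S \<in> sets unit_interval" "?T \<in> sets unit_interval"
      using ST by (auto intro!: measurable_sets)
    have "(\<integral>z. indicator (S \<times> T) (map_prod (\<phi> n) (\<phi> n) z) * D n z \<partial>unit_square)
        = (LINT z:?S \<times> ?T|unit_square. D n z)"
      unfolding set_lebesgue_integral_def
      by (intro Bochner_Integration.integral_cong)
        (auto simp: indicator_def space_unit_square space_unit_interval)
    thus "norm (\<integral>z. indicator (S \<times> T) (map_prod (\<phi> n) (\<phi> n) z) * D n z \<partial>unit_square)
        \<le> cut_norm (D n)"
      using rectangle_le_cut_norm[OF intD m] by simp
  qed
  have ind: "P (indicator A)" if "A \<in> sets unit_square" for A
    using Int_stable_pair_measure_generator[of unit_interval unit_interval]
      pair_measure_closed[of unit_interval unit_interval]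
      that[unfolded unit_square_def sets_pair_measure]
  proof (induction rule: sigma_sets_induct_disjoint)
    case (basic A)
    thus ?case using rectangle by auto
  next
    case empty
    show ?case by (simp add: P_def)
  next
    case (compl A)
    hence A: "A \<in> sets unit_square" unfolding unit_square_def sets_pair_measure by simp
    have intA: "integrable unit_square (indicat_real A)" by (rule unit_square.integrable_indicat_real[OF A])
    have intQ: "integrable unit_square (indicat_real ({0..1} \<times> {0..1}))"
      using unit_square.integrable_indicat_real[OF sets.top] by (simp add: space_unit_square)
    \<comment> \<open>The integral of \<open>D n\<close> itself need not vanish; it tends to 0
      because the whole square is a rectangle.\<close>
    have "P (indicator ({0..1} \<times> {0..1}))"
      using rectangle[OF sets.top sets.top] by (simp add: space_unit_interval)
    from tendsto_diff[OF this[unfolded P_def] compl(2)[unfolded P_def]]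
    have *: "(\<lambda>n. \<integral>z. (indicator ({0..1} \<times> {0..1}) (map_prod (\<phi> n) (\<phi> n) z)
        - indicator A (map_prod (\<phi> n) (\<phi> n) z)) * D n z \<partial>unit_square) \<longlonglongrightarrow> 0"
      by (simp add: left_diff_distrib Bochner_Integration.integral_diff[OF prod prod] intA intQ)
    have "indicat_real (space unit_interval \<times> space unit_interval - A) z
        = indicator ({0..1} \<times> {0..1}) z - indicator A z" for z
      using sets.sets_into_space[OF A]
      by (auto simp: indicator_def space_unit_square space_unit_interval)
    thus ?case using * unfolding P_def by simp
  next
    case (union A)
    hence A: "\<And>i. A i \<in> sets unit_square"
      unfolding unit_square_def sets_pair_measure by auto
    have sums: "(\<lambda>i. indicat_real (A i) z) sums indicator (\<Union>i. A i) z" for z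
      using union(1) by (intro indicator_sums) (auto simp: disjoint_family_on_def)
    show ?case unfolding P_def
    \<comment> \<open>The rates for the individual \<open>A i\<close> are unrelated, so the limits
      cannot be summed termwise; the partial sums serve as dominated approximations instead.\<close>
    proof (rule tendsto_integral_dominated_approx[OF mp D,
          where s = "\<lambda>i z. \<Sum>j<i. indicat_real (A j) z"])
      show "integrable unit_square (\<lambda>z. \<Sum>j<i. indicat_real (A j) z)" for i
        by (intro Bochner_Integration.integrable_sum unit_square.integrable_indicat_real A)
      show "integrable unit_square (indicat_real (\<Union>i. A i))"
        using A by (intro unit_square.integrable_indicat_real) auto
      show "(\<lambda>i. \<Sum>j<i. indicat_real (A j) z) \<longlonglongrightarrow> indicator (\<Union>i. A i) z" for z
        using sums[of z] by (simp add: sums_def)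
      show "\<bar>\<Sum>j<i. indicat_real (A j) z\<bar> \<le> 2 * \<bar>indicat_real (\<Union>i. A i) z\<bar>" for i z
      proof -
        have "(\<Sum>j<i. indicat_real (A j) z) \<le> indicator (\<Union>i. A i) z"
          using sum_le_suminf[OF sums_summable[OF sums[of z]], of "{..<i}"]
            sums_unique[OF sums[of z]] by simp
        moreover have "0 \<le> (\<Sum>j<i. indicat_real (A j) z)" by (simp add: sum_nonneg)
        ultimately show ?thesis using indicator_pos_le[of "\<Union>i. A i" z] by linarith
      qed
      show "(\<lambda>n. \<integral>z. (\<Sum>j<i. indicat_real (A j) (map_prod (\<phi> n) (\<phi> n) z)) * D n z \<partial>unit_square)
          \<longlonglongrightarrow> 0" for i
      proof -
        have "(\<lambda>n. \<Sum>j<i. \<integral>z. indicat_real (A j) (map_prod (\<phi> n) (\<phi> n) z) * D n z \<partial>unit_square)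
            \<longlonglongrightarrow> (\<Sum>j<i. 0)"
          using union(3) unfolding P_def by (intro tendsto_sum)
        moreover have "integrable unit_square
            (\<lambda>z. indicat_real (A j) (map_prod (\<phi> n) (\<phi> n) z) * D n z)" for j n
          by (intro prod unit_square.integrable_indicat_real A)
        ultimately show ?thesis
          by (simp only: sum_distrib_right Bochner_Integration.integral_sum sum.neutral_const)
      qed
    qed auto
  qed
  from f have "P f"
  proof (induction rule: integrable_induct)
    case (base A c)
    from tendsto_mult_left[OF ind[OF base(1), unfolded P_def], of c]
    show ?case unfolding P_def by (simp add: mult.assoc mult.left_commute[of _ c])
  next
    case (add f g)
    from tendsto_add[OF add(3,4)[unfolded P_def]] prod[OF add(1)] prod[OF add(2)]
    show ?case unfolding P_def by (simp add: distrib_right)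
  next
    case (lim f s)
    show ?case unfolding P_def
      by (rule tendsto_integral_dominated_approx[OF mp D lim(1,2) _ lim(4)])
        (use lim(3,5) in \<open>auto simp: P_def\<close>)
  qed
  thus ?thesis by (simp add: P_def)
qed

section \<open>Entropy under the cut distance\<close>

text \<open>The Fenchel-Young inequality: \<open>exp (s - 1)\<close> is the convex conjugate of
  \<open>x ln x\<close>. It is \<open>ln t \<le> t - 1\<close> at
  \<open>t = exp (s - 1) / x\<close>. The tangent at a point \<open>y > 0\<close> has slope
  \<open>s = 1 + ln y\<close>, and then \<open>exp (s - 1) = y\<close>.\<close>

lemma mult_ln_ge_tangent:
  fixes x s :: real
  assumes "0 \<le> x"
  shows "s * x - exp (s - 1) \<le> x * ln x"
proof (cases "x = 0")
  case False
  hence x: "x > 0" using assms by simp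
  have "ln (exp (s - 1) / x) \<le> exp (s - 1) / x - 1"
    using x by (intro ln_le_minus_one) simp
  hence "s - ln x \<le> exp (s - 1) / x"
    using x by (simp add: ln_div)
  thus ?thesis using x by (simp add: field_simps)
qed simp

lemma abs_mult_ln_le:
  fixes x :: real
  assumes "x \<in> {0..1}"
  shows "\<bar>x * ln x\<bar> \<le> 1"
proof -
  have "x * ln x \<le> 0"
    using assms by (cases "x = 0") (auto intro: mult_nonneg_nonpos)
  moreover have "- exp (- 1) \<le> x * ln x"
    \<comment> \<open>The horizontal tangent gives the minimum of \<open>x ln x\<close>.\<close>
    using mult_ln_ge_tangent[of x 0] assms by simp
  moreover have "exp (- 1) \<le> (1 :: real)" by simp
  ultimately show ?thesis by linarith
qed

lemma integrable_mult_ln: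
  assumes "w \<in> borel_measurable unit_square" "\<And>z. z \<in> space unit_square \<Longrightarrow> w z \<in> {0..1}"
  shows "integrable unit_square (\<lambda>z. w z * ln (w z :: real))"
  using assms by (intro unit_square.integrable_bounded[where B = 1] abs_mult_ln_le) auto

text \<open>The tangent function of \<open>x ln x\<close> along \<open>u\<close>, truncated to stay bounded, is a fixed test
  function: cut norm convergence is tested against its rearrangements only.\<close>

lemma entropy_le_if_cut_norm_tendsto:
  fixes u w :: "real \<times> real \<Rightarrow> real" and \<phi> \<psi> :: "nat \<Rightarrow> real \<Rightarrow> real"
  assumes u: "u \<in> borel_measurable unit_square" "\<And>z. z \<in> space unit_square \<Longrightarrow> u z \<in> {0..1}"
    and w: "w \<in> borel_measurable unit_square" "\<And>z. z \<in> space unit_square \<Longrightarrow> w z \<in> {0..1}"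
    and mp: "\<And>n. measure_preserving (\<phi> n)" "\<And>n. measure_preserving (\<psi> n)"
    and cut: "(\<lambda>n. cut_norm (\<lambda>z. u (map_prod (\<phi> n) (\<phi> n) z) - w (map_prod (\<psi> n) (\<psi> n) z)))
      \<longlonglongrightarrow> 0"
  shows "(\<integral>z. u z * ln (u z) \<partial>unit_square) \<le> (\<integral>z. w z * ln (w z) \<partial>unit_square)"
proof -
  note [measurable] = u(1) w(1) measurable_map_prod[OF mp(1)] measurable_map_prod[OF mp(2)]
  define D where "D n z = u (map_prod (\<phi> n) (\<phi> n) z) - w (map_prod (\<psi> n) (\<psi> n) z)" for n z
  have D[measurable]: "D n \<in> borel_measurable unit_square" for n
    unfolding D_def by measurable
  have \<Phi>: "map_prod (\<phi> n) (\<phi> n) z \<in> space unit_square"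
    and \<Psi>: "map_prod (\<psi> n) (\<psi> n) z \<in> space unit_square"
    if "z \<in> space unit_square" for n z
    using measurable_space[OF measurable_map_prod[OF mp(1)] that]
      measurable_space[OF measurable_map_prod[OF mp(2)] that] by auto
  have D_le: "\<bar>D n z\<bar> \<le> 1" if "z \<in> space unit_square" for n z
    using u(2)[OF \<Phi>[OF that, of n]] w(2)[OF \<Psi>[OF that, of n]] by (auto simp: D_def)
  have bound: "(\<integral>z. u z * ln (u z) \<partial>unit_square) - 1 / real (Suc m)
      \<le> (\<integral>z. w z * ln (w z) \<partial>unit_square)" for m
  proof -
    \<comment> \<open>The floor keeps \<open>ln (t z)\<close> bounded where \<open>u\<close> is
      close to 0, so that the slope \<open>s\<close> is an admissible test function.\<close>
    define t where "t z = max (u z) (1 / real (Suc m))" for z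
    define s where "s z = 1 + ln (t z)" for z
    have t_pos: "0 < t z" for z by (auto simp: t_def less_max_iff_disj)
    have t_le: "t z \<le> 1" if "z \<in> space unit_square" for z
      using u(2)[OF that] by (auto simp: t_def)
    have [measurable]: "s \<in> borel_measurable unit_square" unfolding s_def t_def by measurable
    have s_bound: "\<bar>s z\<bar> \<le> 1 + ln (real (Suc m))" if "z \<in> space unit_square" for z
    proof -
      have "- ln (real (Suc m)) \<le> ln (t z)"
        using t_pos[of z] by (subst ln_inverse[symmetric]) (auto simp: t_def inverse_eq_divide)
      moreover have "ln (t z) \<le> 0" using t_le[OF that] t_pos[of z] by simp
      ultimately show ?thesis unfolding s_def by (auto simp: abs_if)
    qed
    have int_s: "integrable unit_square s"
      by (rule unit_square.integrable_bounded[OF _ s_bound]) auto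
    \<comment> \<open>This is the tangent at \<open>t z\<close> evaluated at \<open>u z\<close>. As
      \<open>exp (s z - 1) = t z\<close>, it falls below \<open>u z * ln (u z)\<close> by at most
      \<open>t z - u z\<close>, hence by at most \<open>1 / real (Suc m)\<close>.\<close>
    define J where "J z = s z * u z - exp (s z - 1)" for z
    have [measurable]: "J \<in> borel_measurable unit_square" unfolding J_def by measurable
    have J_ge: "u z * ln (u z) - 1 / real (Suc m) \<le> J z" if z: "z \<in> space unit_square" for z
    proof -
      have "u z * ln (u z) \<le> u z * ln (t z)"
        using u(2)[OF z] by (cases "u z = 0") (auto intro!: mult_left_mono simp: t_def)
      moreover have "t z \<le> u z + 1 / real (Suc m)" using u(2)[OF z] by (auto simp: t_def)
      ultimately show ?thesis using t_pos[of z] by (simp add: J_def s_def algebra_simps)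
    qed
    have s1: "s z \<le> 1" if "z \<in> space unit_square" for z
      using t_le[OF that] t_pos[of z] by (simp add: s_def)
    have J_bound: "\<bar>J z\<bar> \<le> 2 + ln (real (Suc m))" if z: "z \<in> space unit_square" for z
    proof -
      have "\<bar>s z * u z\<bar> \<le> (1 + ln (real (Suc m))) * 1"
        unfolding abs_mult using u(2)[OF z] s_bound[OF z] by (intro mult_mono) auto
      hence "\<bar>s z * u z\<bar> + \<bar>exp (s z - 1)\<bar> \<le> (1 + ln (real (Suc m))) * 1 + 1"
        using s1[OF z] by (intro add_mono) auto
      thus ?thesis
        using abs_triangle_ineq4[of "s z * u z" "exp (s z - 1)"] by (simp add: J_def)
    qed
    have int_J: "integrable unit_square J"
      by (rule unit_square.integrable_bounded[OF _ J_bound]) auto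
    have int_w: "integrable unit_square (\<lambda>z. w z * ln (w z))"
      and int_u: "integrable unit_square (\<lambda>z. u z * ln (u z))"
      using u w by (intro integrable_mult_ln; auto)+
    have step: "(\<integral>z. J z \<partial>unit_square) - (\<integral>z. s (map_prod (\<phi> n) (\<phi> n) z) * D n z \<partial>unit_square)
        \<le> (\<integral>z. w z * ln (w z) \<partial>unit_square)" for n
    proof -
      let ?\<Phi> = "map_prod (\<phi> n) (\<phi> n)" and ?\<Psi> = "map_prod (\<psi> n) (\<psi> n)"
      have int_J': "integrable unit_square (\<lambda>z. J (?\<Phi> z))"
        using int_J integrable_map_prod[OF mp(1), of J n] by simp
      have int_w': "integrable unit_square (\<lambda>z. w (?\<Psi> z) * ln (w (?\<Psi> z)))"
        using int_w integrable_map_prod[OF mp(2), of "\<lambda>z. w z * ln (w z)" n] by simp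
      have int_sD: "integrable unit_square (\<lambda>z. s (?\<Phi> z) * D n z)"
      proof (rule unit_square.integrable_bounded[where B = "1 + ln (real (Suc m))"])
        fix z assume z: "z \<in> space unit_square"
        show "\<bar>s (?\<Phi> z) * D n z\<bar> \<le> 1 + ln (real (Suc m))"
          using mult_mono[OF s_bound[OF \<Phi>[OF z, of n]] D_le[OF z, of n]]
          by (simp add: abs_mult)
      qed measurable
      have "(\<integral>z. J z \<partial>unit_square) - (\<integral>z. s (?\<Phi> z) * D n z \<partial>unit_square)
          = (\<integral>z. J (?\<Phi> z) \<partial>unit_square) - (\<integral>z. s (?\<Phi> z) * D n z \<partial>unit_square)"
        using integral_map_prod[OF mp(1), of J n] by simp
      also have "\<dots> = (\<integral>z. J (?\<Phi> z) - s (?\<Phi> z) * D n z \<partial>unit_square)"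
        using int_J' int_sD by simp
      also have "\<dots> \<le> (\<integral>z. w (?\<Psi> z) * ln (w (?\<Psi> z)) \<partial>unit_square)"
      proof (rule integral_mono[OF Bochner_Integration.integrable_diff[OF int_J' int_sD] int_w'])
        fix z assume z: "z \<in> space unit_square"
        \<comment> \<open>Since \<open>w (?\<Psi> z) = u (?\<Phi> z) - D n z\<close>, the left side
          is the tangent of slope \<open>s (?\<Phi> z)\<close> evaluated at
          \<open>w (?\<Psi> z)\<close>.\<close>
        show "J (?\<Phi> z) - s (?\<Phi> z) * D n z \<le> w (?\<Psi> z) * ln (w (?\<Psi> z))"
          using mult_ln_ge_tangent[of "w (?\<Psi> z)" "s (?\<Phi> z)"] w(2)[OF \<Psi>[OF z, of n]]
          by (simp add: J_def D_def algebra_simps)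
      qed
      also have "\<dots> = (\<integral>z. w z * ln (w z) \<partial>unit_square)"
        using integral_map_prod[OF mp(2), of "\<lambda>z. w z * ln (w z)" n] by simp
      finally show ?thesis .
    qed
    have "(\<lambda>n. \<integral>z. s (map_prod (\<phi> n) (\<phi> n) z) * D n z \<partial>unit_square) \<longlonglongrightarrow> 0"
      using cut by (intro tendsto_integral_cut_norm[OF mp(1) D D_le _ int_s])
        (simp_all add: D_def[abs_def])
    from tendsto_diff[OF tendsto_const this, of "\<integral>z. J z \<partial>unit_square"]
    have "(\<integral>z. J z \<partial>unit_square) \<le> (\<integral>z. w z * ln (w z) \<partial>unit_square)"
      using step by (intro LIMSEQ_le_const2[where X =
          "\<lambda>n. (\<integral>z. J z \<partial>unit_square) - (\<integral>z. s (map_prod (\<phi> n) (\<phi> n) z) * D n z \<partial>unit_square)"])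
        auto
    moreover have "(\<integral>z. u z * ln (u z) - 1 / real (Suc m) \<partial>unit_square) \<le> (\<integral>z. J z \<partial>unit_square)"
      using int_u int_J J_ge by (intro integral_mono) auto
    ultimately show ?thesis using int_u by (simp add: unit_square.prob_space)
  qed
  have "(\<lambda>m. (\<integral>z. u z * ln (u z) \<partial>unit_square) - 1 / real (Suc m)) \<longlonglongrightarrow>
      (\<integral>z. u z * ln (u z) \<partial>unit_square) - 0"
    by (intro tendsto_diff tendsto_const LIMSEQ_Suc lim_1_over_n)
  thus ?thesis using bound by (intro LIMSEQ_le_const2) auto
qed

section \<open>Consequences of cut distance zero\<close>

lemma cut_norm_zero: "cut_norm (\<lambda>z. 0) = 0"
proof -
  have "sets unit_interval \<times> sets unit_interval \<noteq> {}" by blast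
  thus ?thesis by (simp add: cut_norm_def set_lebesgue_integral_def case_prod_unfold)
qed

lemma cut_norm_uminus: "cut_norm (\<lambda>z. - U z) = cut_norm U"
  by (simp add: cut_norm_def set_lebesgue_integral_def)

lemma
  assumes "W \<in> graphons k" "a \<in> {1..k}"
  shows measurable_graphon: "W a \<in> borel_measurable unit_square"
    and graphon_range: "z \<in> space unit_square \<Longrightarrow> W a z \<in> {0..1}"
    and graphon_sym: "(x, y) \<in> space unit_square \<Longrightarrow> W a (y, x) = W a (x, y)"
  using assms by (auto simp: graphons_def space_unit_square)

lemma graphon_sum:
  assumes "W \<in> graphons k" "z \<in> space unit_square"
  shows "(\<Sum>a=1..k. W a z) = 1"
  using assms by (auto simp: graphons_def space_unit_square)

lemma mp_bijections_measure_preserving: "\<phi> \<in> mp_bijections \<Longrightarrow> measure_preserving \<phi>"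
  by (simp add: mp_bijections_def measure_preserving_def)

lemma id_in_mp_bijections: "(\<lambda>x. x) \<in> mp_bijections"
  by (auto simp: mp_bijections_def bij_betw_def)

lemma measure_preserving_id: "measure_preserving (\<lambda>x. x)"
  by (rule mp_bijections_measure_preserving[OF id_in_mp_bijections])

lemma integrable_graphon_diff:
  assumes "U \<in> graphons k" "W \<in> graphons k" "a \<in> {1..k}" "measure_preserving \<phi>"
  shows "integrable unit_square (\<lambda>z. U a z - W a (map_prod \<phi> \<phi> z))"
proof (rule unit_square.integrable_bounded[where B = 1])
  note [measurable] = measurable_graphon[OF assms(1,3)] measurable_graphon[OF assms(2,3)]
    measurable_map_prod[OF assms(4)]
  show "(\<lambda>z. U a z - W a (map_prod \<phi> \<phi> z)) \<in> borel_measurable unit_square" by measurable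
  fix z assume z: "z \<in> space unit_square"
  show "\<bar>U a z - W a (map_prod \<phi> \<phi> z)\<bar> \<le> 1"
    using graphon_range[OF assms(1,3) z]
      graphon_range[OF assms(2,3) measurable_space[OF measurable_map_prod[OF assms(4)] z]]
    by auto
qed

lemma cut_distance_eq:
  "cut_distance k U W =
     (INF \<phi>\<in>mp_bijections. \<Sum>a=1..k. cut_norm (\<lambda>z. U a z - W a (map_prod \<phi> \<phi> z)))"
  by (simp add: cut_distance_def case_prod_unfold map_prod_def)

lemma cut_distance_bdd_below:
  assumes "U \<in> graphons k" "W \<in> graphons k"
  shows "bdd_below ((\<lambda>\<phi>. \<Sum>a=1..k. cut_norm (\<lambda>z. U a z - W a (map_prod \<phi> \<phi> z))) ` mp_bijections)"
proof (rule bdd_belowI2[where m = 0])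
  fix \<phi> assume \<phi>: "\<phi> \<in> mp_bijections"
  show "0 \<le> (\<Sum>a=1..k. cut_norm (\<lambda>z. U a z - W a (map_prod \<phi> \<phi> z)))"
    by (intro sum_nonneg cut_norm_nonneg integrable_graphon_diff[OF assms]
        mp_bijections_measure_preserving[OF \<phi>])
qed

lemma cut_distance_self:
  assumes "W \<in> graphons k"
  shows "cut_distance k W W = 0"
proof (rule antisym)
  have "cut_distance k W W \<le> (\<Sum>a=1..k. cut_norm (\<lambda>z. W a z - W a (map_prod (\<lambda>x. x) (\<lambda>x. x) z)))"
    unfolding cut_distance_eq
    by (rule cINF_lower[OF cut_distance_bdd_below[OF assms assms] id_in_mp_bijections])
  also have "\<dots> = 0"
    by (simp add: cut_norm_zero map_prod_def case_prod_unfold)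
  finally show "cut_distance k W W \<le> 0" .
  show "0 \<le> cut_distance k W W"
    unfolding cut_distance_eq
    using id_in_mp_bijections
    by (intro cINF_greatest sum_nonneg cut_norm_nonneg integrable_graphon_diff[OF assms assms]
        mp_bijections_measure_preserving) blast+
qed

text \<open>Near-minimisers of the infimum are all that distance zero provides. The summands are
  nonnegative, so a small total forces every single colour to be small.\<close>

lemma cut_distance_zero_sequence:
  assumes "U \<in> graphons k" "W \<in> graphons k" "cut_distance k U W = 0"
  obtains \<phi> :: "nat \<Rightarrow> real \<Rightarrow> real" where "\<And>n. measure_preserving (\<phi> n)"
    "\<And>a. a \<in> {1..k} \<Longrightarrow> (\<lambda>n. cut_norm (\<lambda>z. U a z - W a (map_prod (\<phi> n) (\<phi> n) z))) \<longlonglongrightarrow> 0"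
proof -
  let ?N = "\<lambda>\<phi>. \<Sum>a=1..k. cut_norm (\<lambda>z. U a z - W a (map_prod \<phi> \<phi> z))"
  have "\<exists>\<phi>\<in>mp_bijections. ?N \<phi> < 1 / real (Suc n)" for n
  proof -
    have "mp_bijections \<noteq> {}" using id_in_mp_bijections by blast
    moreover have "(INF \<phi>\<in>mp_bijections. ?N \<phi>) < 1 / real (Suc n)"
      using assms(3) by (simp add: cut_distance_eq)
    ultimately show ?thesis
      using cINF_less_iff[OF _ cut_distance_bdd_below[OF assms(1,2)]] by blast
  qed
  hence "\<forall>n. \<exists>\<phi>. \<phi> \<in> mp_bijections \<and> ?N \<phi> < 1 / real (Suc n)" by blast
  from choice[OF this] obtain \<phi> where
    \<phi>: "\<And>n. \<phi> n \<in> mp_bijections" "\<And>n. ?N (\<phi> n) < 1 / real (Suc n)"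
    by blast
  note mp = mp_bijections_measure_preserving[OF \<phi>(1)]
  note nonneg = cut_norm_nonneg[OF integrable_graphon_diff[OF assms(1,2) _ mp]]
  show thesis
  proof (rule that[OF mp])
    fix a assume a: "a \<in> {1..k}"
    show "(\<lambda>n. cut_norm (\<lambda>z. U a z - W a (map_prod (\<phi> n) (\<phi> n) z))) \<longlonglongrightarrow> 0"
    proof (rule Lim_null_comparison[OF always_eventually])
      show "\<forall>n. norm (cut_norm (\<lambda>z. U a z - W a (map_prod (\<phi> n) (\<phi> n) z))) \<le> 1 / real (Suc n)"
      proof
        fix n
        have "cut_norm (\<lambda>z. U a z - W a (map_prod (\<phi> n) (\<phi> n) z)) \<le> ?N (\<phi> n)"
          using a nonneg by (intro member_le_sum) auto
        thus "norm (cut_norm (\<lambda>z. U a z - W a (map_prod (\<phi> n) (\<phi> n) z))) \<le> 1 / real (Suc n)"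
          using \<phi>(2)[of n] nonneg[OF a, of n] by simp
      qed
      show "(\<lambda>n. 1 / real (Suc n)) \<longlonglongrightarrow> 0" by (rule LIMSEQ_Suc[OF lim_1_over_n])
    qed
  qed
qed

text \<open>The one-sided comparison is used twice with the same maps, first with the identity on
  \<open>U\<close> and the maps on \<open>W\<close>, then with the two arguments exchanged. This is
  why \<open>entropy_le_if_cut_norm_tendsto\<close> admits a family of maps on each side.\<close>

lemma entropy_functional_cut_distance_zero:
  assumes "U \<in> graphons k" "W \<in> graphons k" "cut_distance k U W = 0"
  shows "entropy_functional k U = entropy_functional k W"
proof -
  obtain \<phi> :: "nat \<Rightarrow> real \<Rightarrow> real" where mp: "\<And>n. measure_preserving (\<phi> n)" and
    lim: "\<And>a. a \<in> {1..k} \<Longrightarrow> (\<lambda>n. cut_norm (\<lambda>z. U a z - W a (map_prod (\<phi> n) (\<phi> n) z))) \<longlonglongrightarrow> 0"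
    using cut_distance_zero_sequence[OF assms] by blast
  show ?thesis unfolding entropy_functional_def
  proof (intro sum.cong refl antisym)
    fix a assume a: "a \<in> {1..k}"
    note U = measurable_graphon[OF assms(1) a] graphon_range[OF assms(1) a]
    note W = measurable_graphon[OF assms(2) a] graphon_range[OF assms(2) a]
    show "(\<integral>z. U a z * ln (U a z) \<partial>unit_square) \<le> (\<integral>z. W a z * ln (W a z) \<partial>unit_square)"
      by (rule entropy_le_if_cut_norm_tendsto[OF U W measure_preserving_id mp])
        (use lim[OF a] in \<open>simp_all add: map_prod_def\<close>)
    have "(\<lambda>n. cut_norm (\<lambda>z. W a (map_prod (\<phi> n) (\<phi> n) z) - U a z)) \<longlonglongrightarrow> 0"
      using lim[OF a] cut_norm_uminus[of "\<lambda>z. U a z - W a (map_prod (\<phi> _) (\<phi> _) z)"] by simp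
    thus "(\<integral>z. W a z * ln (W a z) \<partial>unit_square) \<le> (\<integral>z. U a z * ln (U a z) \<partial>unit_square)"
      by (intro entropy_le_if_cut_norm_tendsto[OF W U mp measure_preserving_id])
        (simp_all add: map_prod_def)
  qed
qed

section \<open>Homomorphism densities under the cut distance\<close>

abbreviation unit_cube :: "'v set \<Rightarrow> ('v \<Rightarrow> real) measure" where
  "unit_cube V \<equiv> \<Pi>\<^sub>M v\<in>V. unit_interval"

lemma prob_space_unit_cube: "prob_space (unit_cube V)"
  by (intro prob_space_PiM unit_interval.prob_space_axioms)

lemma space_unit_cube: "space (unit_cube V) = V \<rightarrow>\<^sub>E {0..1}"
  by (simp add: space_PiM space_unit_interval)

lemma measurable_insert_pair:
  assumes "u \<in> V" "v \<in> V" "u \<noteq> v"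
  shows "(\<lambda>(q, z). q(u := fst z, v := snd z)) \<in>
    unit_cube (V - {u, v}) \<Otimes>\<^sub>M unit_square \<rightarrow>\<^sub>M unit_cube V"
proof -
  let ?N = "unit_cube (V - {u, v}) \<Otimes>\<^sub>M (unit_interval \<Otimes>\<^sub>M unit_interval)"
  have "(\<lambda>w. (fst w)(u := fst (snd w))) \<in> ?N \<rightarrow>\<^sub>M unit_cube (V - {v})"
    by (rule measurable_fun_upd[where J = "V - {u, v}"]) (use assms in \<open>auto intro: measurable_fst\<close>)
  hence "(\<lambda>w. (fst w)(u := fst (snd w), v := snd (snd w))) \<in> ?N \<rightarrow>\<^sub>M unit_cube V"
    by (rule measurable_fun_upd[rotated]) (use assms in auto)
  thus ?thesis by (simp add: unit_square_def case_prod_unfold)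
qed

text \<open>The two orders serve different ends. With the other coordinates frozen outside, the
  inner integral is a cut norm expression on the square; with them integrated out inside, a kernel
  on the square remains, which becomes the edge marginal.\<close>

lemma
  fixes G :: "('v \<Rightarrow> real) \<Rightarrow> real"
  assumes V: "finite V" "u \<in> V" "v \<in> V" "u \<noteq> v"
    and G: "G \<in> borel_measurable (unit_cube V)"
      "\<And>p. p \<in> space (unit_cube V) \<Longrightarrow> \<bar>G p\<bar> \<le> B"
  shows integral_split_pair:
      "(\<integral>p. G p \<partial>unit_cube V) =
        (\<integral>q. (\<integral>z. G (q(u := fst z, v := snd z)) \<partial>unit_square) \<partial>unit_cube (V - {u, v}))"
    and integral_split_pair_swap:
      "(\<integral>p. G p \<partial>unit_cube V) =
        (\<integral>z. (\<integral>q. G (q(u := fst z, v := snd z)) \<partial>unit_cube (V - {u, v})) \<partial>unit_square)"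
proof -
  define R where "R = V - {u, v}"
  interpret R: prob_space "unit_cube R" by (rule prob_space_unit_cube)
  interpret V: prob_space "unit_cube V" by (rule prob_space_unit_cube)
  interpret vR: prob_space "unit_cube (insert v R)" by (rule prob_space_unit_cube)
  interpret RQ: pair_prob_space "unit_cube R" unit_square ..
  interpret ps: product_sigma_finite "\<lambda>_ :: 'v. unit_interval"
    by unfold_locales
  have VR: "V = insert u (insert v R)" and uv: "u \<notin> insert v R" "v \<notin> R" and fin: "finite R"
    using V by (auto simp: R_def)
  note [measurable] = G(1)
  have intG: "integrable (unit_cube V) G" by (rule V.integrable_bounded[OF G])
  have upd_space: "(p(u := x)) \<in> space (unit_cube V)"
    if "p \<in> space (unit_cube (insert v R))" "x \<in> {0..1}" for p x
    using that uv(1) by (auto simp: space_unit_cube VR PiE_def extensional_def Pi_def)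
  have pair_space: "q(u := fst z, v := snd z) \<in> space (unit_cube V)"
    if "q \<in> space (unit_cube R)" "z \<in> space unit_square" for q z
    using that by (auto simp: space_unit_cube space_unit_square VR PiE_def extensional_def Pi_def)
  have meas_upd: "(\<lambda>(p, x). G (p(u := x))) \<in>
      borel_measurable (unit_cube (insert v R) \<Otimes>\<^sub>M unit_interval)"
    using measurable_compose[OF measurable_add_dim G(1)[unfolded VR]]
    by (simp add: case_prod_unfold)
  \<comment> \<open>The product integral peels off one coordinate at a time, first \<open>u\<close>,
    then \<open>v\<close>; the two resulting integrals are merged into one over the square
    afterwards.\<close>
  define F where "F p = (\<integral>x. G (p(u := x)) \<partial>unit_interval)" for p
  have F_meas: "F \<in> borel_measurable (unit_cube (insert v R))"
    unfolding F_def using meas_upd by (intro unit_interval.borel_measurable_lebesgue_integral)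
  have F_bound: "\<bar>F p\<bar> \<le> B" if p: "p \<in> space (unit_cube (insert v R))" for p
  proof -
    have "\<bar>F p\<bar> \<le> (\<integral>x. \<bar>G (p(u := x))\<bar> \<partial>unit_interval)"
      unfolding F_def using integral_norm_bound[of unit_interval "\<lambda>x. G (p(u := x))"] by simp
    also have "\<dots> \<le> B"
    proof (rule unit_interval.integral_le_const)
      show "integrable unit_interval (\<lambda>x. \<bar>G (p(u := x))\<bar>)"
        using measurable_compose[OF measurable_Pair1'[OF p] meas_upd] G(2)[OF upd_space[OF p]]
        by (intro unit_interval.integrable_bounded[where B = B])
          (auto simp: space_unit_interval)
    qed (use G(2)[OF upd_space[OF p]] in \<open>auto simp: space_unit_interval\<close>)
    finally show ?thesis .
  qed
  have meas_pair: "(\<lambda>(q, z). G (q(u := fst z, v := snd z))) \<in>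
      borel_measurable (unit_cube R \<Otimes>\<^sub>M unit_square)"
    using measurable_compose[OF measurable_insert_pair[OF V(2-4)] G(1)]
    by (simp add: R_def case_prod_unfold)
  have int_pair: "integrable (unit_cube R \<Otimes>\<^sub>M unit_square) (\<lambda>(q, z). G (q(u := fst z, v := snd z)))"
    using G(2)[OF pair_space]
    by (intro RQ.integrable_bounded[OF meas_pair, where B = B])
      (auto simp: space_pair_measure)
  have "(\<integral>p. G p \<partial>unit_cube V) = (\<integral>p. F p \<partial>unit_cube (insert v R))"
    using ps.product_integral_insert[of "insert v R" u G] fin uv intG by (simp add: VR F_def)
  also have "\<dots> = (\<integral>q. (\<integral>y. F (q(v := y)) \<partial>unit_interval) \<partial>unit_cube R)"
    using ps.product_integral_insert[of R v F] fin uv vR.integrable_bounded[OF F_meas F_bound]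
    by simp
  also have "\<dots> = (\<integral>q. (\<integral>z. G (q(u := fst z, v := snd z)) \<partial>unit_square) \<partial>unit_cube R)"
  proof (rule Bochner_Integration.integral_cong[OF refl])
    fix q assume q: "q \<in> space (unit_cube R)"
    have "integrable unit_square (\<lambda>z. G (q(u := fst z, v := snd z)))"
      using measurable_compose[OF measurable_Pair1'[OF q] meas_pair] G(2)[OF pair_space[OF q]]
      by (intro unit_square.integrable_bounded[where B = B]) auto
    hence "integrable (unit_interval \<Otimes>\<^sub>M unit_interval) (\<lambda>(x, y). G (q(u := x, v := y)))"
      by (simp add: unit_square_def case_prod_unfold)
    from unit_interval_pair.integral_snd[OF this]
    show "(\<integral>y. F (q(v := y)) \<partial>unit_interval) = (\<integral>z. G (q(u := fst z, v := snd z)) \<partial>unit_square)"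
      using V(4) by (simp add: F_def unit_square_def case_prod_unfold fun_upd_twist)
  qed
  finally show 1: "(\<integral>p. G p \<partial>unit_cube V) =
      (\<integral>q. (\<integral>z. G (q(u := fst z, v := snd z)) \<partial>unit_square) \<partial>unit_cube (V - {u, v}))"
    by (simp add: R_def)
  show "(\<integral>p. G p \<partial>unit_cube V) =
      (\<integral>z. (\<integral>q. G (q(u := fst z, v := snd z)) \<partial>unit_cube (V - {u, v})) \<partial>unit_square)"
    unfolding 1 R_def[symmetric] by (rule RQ.Fubini_integral[OF int_pair, symmetric])
qed

section \<open>Edge products and the counting lemma\<close>

text \<open>The weight is indexed by the edge and not by its colour, so that a single edge can be
  replaced while others of the same colour keep their weight.\<close>

definition edge_product ::
  "('v \<times> 'v) set \<Rightarrow> ('v \<times> 'v \<Rightarrow> real \<times> real \<Rightarrow> real) \<Rightarrow> ('v \<Rightarrow> real) \<Rightarrow> real" where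
  "edge_product E F p = (\<Prod>e\<in>E. F e (p (fst e), p (snd e)))"

definition simple_edges :: "'v set \<Rightarrow> ('v \<times> 'v) set \<Rightarrow> bool" where
  "simple_edges V E \<longleftrightarrow> finite V \<and> E \<subseteq> V \<times> V \<and>
     (\<forall>u v. (u, v) \<in> E \<longrightarrow> u \<noteq> v \<and> (v, u) \<notin> E)"

lemma simple_edges_finite: "simple_edges V E \<Longrightarrow> finite E"
  unfolding simple_edges_def by (meson finite_SigmaI finite_subset)

lemma measurable_pair_coordinates:
  assumes "u \<in> V" "v \<in> V"
  shows "(\<lambda>p. (p u, p v)) \<in> unit_cube V \<rightarrow>\<^sub>M unit_square"
  unfolding unit_square_def using assms by (intro measurable_Pair measurable_component_singleton)

lemma coordinates_in_square:
  assumes "p \<in> space (unit_cube V)" "u \<in> V" "v \<in> V"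
  shows "(p u, p v) \<in> space unit_square"
  using assms by (auto simp: space_unit_cube space_unit_square PiE_def Pi_def)

lemma measurable_edge_product:
  assumes "E \<subseteq> V \<times> V" "\<And>e. e \<in> E \<Longrightarrow> F e \<in> borel_measurable unit_square"
  shows "edge_product E F \<in> borel_measurable (unit_cube V)"
  unfolding edge_product_def[abs_def] using assms
  by (intro borel_measurable_prod measurable_compose[OF measurable_pair_coordinates]) auto

lemma abs_edge_product_le:
  assumes "E \<subseteq> V \<times> V" "p \<in> space (unit_cube V)"
    "\<And>e z. e \<in> E \<Longrightarrow> z \<in> space unit_square \<Longrightarrow> \<bar>F e z\<bar> \<le> 1"
  shows "\<bar>edge_product E F p\<bar> \<le> 1"
proof -
  have "\<bar>F e (p (fst e), p (snd e))\<bar> \<le> 1" if "e \<in> E" for e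
    using assms that by (intro assms(3) coordinates_in_square) (auto simp: mem_Times_iff)
  thus ?thesis unfolding edge_product_def abs_prod by (intro prod_le_1) auto
qed

lemma edge_product_in_unit:
  assumes "E \<subseteq> V \<times> V" "p \<in> space (unit_cube V)"
    "\<And>e z. e \<in> E \<Longrightarrow> z \<in> space unit_square \<Longrightarrow> F e z \<in> {0..1}"
  shows "edge_product E F p \<in> {0..1}"
proof -
  have "F e (p (fst e), p (snd e)) \<in> {0..1}" if "e \<in> E" for e
    using assms that by (intro assms(3) coordinates_in_square) (auto simp: mem_Times_iff)
  thus ?thesis unfolding edge_product_def by (auto intro!: prod_nonneg prod_le_1)
qed

lemma integrable_edge_product:
  assumes "E \<subseteq> V \<times> V" "\<And>e. e \<in> E \<Longrightarrow> F e \<in> borel_measurable unit_square"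
    "\<And>e z. e \<in> E \<Longrightarrow> z \<in> space unit_square \<Longrightarrow> \<bar>F e z\<bar> \<le> 1"
  shows "integrable (unit_cube V) (edge_product E F)"
  using prob_space_unit_cube[of V] assms
  by (intro finite_measure.integrable_bounded[where B = 1] measurable_edge_product
      abs_edge_product_le prob_space.finite_measure) auto

lemma edge_product_remove:
  assumes "finite E" "e \<in> E"
  shows "edge_product E F p = F e (p (fst e), p (snd e)) * edge_product (E - {e}) F p"
  unfolding edge_product_def using assms by (rule prod.remove)

text \<open>With all other coordinates frozen, no edge besides \<open>(u, v)\<close> sees both \<open>u\<close> and \<open>v\<close>,
  so the remaining product splits into a function of \<open>x\<^sub>u\<close> times a function of \<open>x\<^sub>v\<close>.\<close>

lemma integral_edge_le_cut_norm:
  assumes E: "simple_edges V E" "(u, v) \<in> E"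
    and D: "D \<in> borel_measurable unit_square" "\<And>z. z \<in> space unit_square \<Longrightarrow> \<bar>D z\<bar> \<le> 1"
    and F: "\<And>e. e \<in> E - {(u, v)} \<Longrightarrow> F e \<in> borel_measurable unit_square"
      "\<And>e z. e \<in> E - {(u, v)} \<Longrightarrow> z \<in> space unit_square \<Longrightarrow> F e z \<in> {0..1}"
  shows "\<bar>\<integral>p. D (p u, p v) * edge_product (E - {(u, v)}) F p \<partial>unit_cube V\<bar> \<le> cut_norm D"
proof -
  define E' where "E' = E - {(u, v)}"
  define R where "R = V - {u, v}"
  \<comment> \<open>An edge at \<open>v\<close> other than \<open>(u, v)\<close> cannot meet
    \<open>u\<close>, by simplicity. Everything else goes into \<open>B\<close>; the edges there
    that avoid \<open>u\<close> too are constant once the other coordinates are frozen.\<close>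
  define A where "A = {e \<in> E'. fst e = v \<or> snd e = v}"
  define B where "B = E' - A"
  have uv: "u \<in> V" "v \<in> V" "u \<noteq> v" and fin: "finite V" "finite E'" and sub: "E' \<subseteq> V \<times> V"
    using E simple_edges_finite[OF E(1)] by (auto simp: simple_edges_def E'_def)
  have asym: "(x, y) \<in> E \<Longrightarrow> x \<noteq> y" "(v, u) \<notin> E" for x y
    using E by (auto simp: simple_edges_def)
  have A: "A \<subseteq> (V - {u}) \<times> (V - {u})"
    using sub uv(3) asym unfolding A_def E'_def by auto
  have B: "B \<subseteq> (V - {v}) \<times> (V - {v})"
    using sub unfolding A_def B_def by auto
  have AB: "A \<subseteq> E'" "B \<subseteq> E'" by (auto simp: A_def B_def)
  note F' = F[folded E'_def]
  interpret R: prob_space "unit_cube R" by (rule prob_space_unit_cube)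
  have intD: "integrable unit_square D"
    using D by (intro unit_square.integrable_bounded[where B = 1])
  define G where "G p = D (p u, p v) * edge_product E' F p" for p
  have G_meas: "G \<in> borel_measurable (unit_cube V)"
    unfolding G_def
    by (intro borel_measurable_times measurable_compose[OF measurable_pair_coordinates D(1)]
        measurable_edge_product[OF sub] uv F')
  have G_bound: "\<bar>G p\<bar> \<le> 1" if p: "p \<in> space (unit_cube V)" for p
    using D(2)[OF coordinates_in_square[OF p uv(1,2)]] edge_product_in_unit[OF sub p F'(2)]
    unfolding G_def abs_mult by (intro mult_le_one) auto
  have inner: "\<bar>\<integral>z. G (q(u := fst z, v := snd z)) \<partial>unit_square\<bar> \<le> cut_norm D"
    if q: "q \<in> space (unit_cube R)" for q
  proof -
    define f where "f x = edge_product B F (q(u := x))" for x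
    define g where "g y = edge_product A F (q(v := y))" for y
    have upd: "(\<lambda>x. q(u := x)) \<in> unit_interval \<rightarrow>\<^sub>M unit_cube (V - {v})"
      "(\<lambda>y. q(v := y)) \<in> unit_interval \<rightarrow>\<^sub>M unit_cube (V - {u})"
      using q uv by (intro measurable_fun_upd[where J = R] measurable_const measurable_ident; auto simp: R_def)+
    have fg_meas: "f \<in> borel_measurable unit_interval" "g \<in> borel_measurable unit_interval"
      unfolding f_def g_def using F'(1) AB
      by (intro measurable_compose[OF upd(1)] measurable_compose[OF upd(2)]
          measurable_edge_product A B; auto)+
    have f_range: "f x \<in> {0..1}" if "x \<in> {0..1}" for x
      unfolding f_def using that measurable_space[OF upd(1)] F'(2) AB
      by (intro edge_product_in_unit[OF B]) (auto simp: space_unit_interval)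
    have g_range: "g x \<in> {0..1}" if "x \<in> {0..1}" for x
      unfolding g_def using that measurable_space[OF upd(2)] F'(2) AB
      by (intro edge_product_in_unit[OF A]) (auto simp: space_unit_interval)
    have "G (q(u := fst z, v := snd z)) = f (fst z) * g (snd z) * D z" for z
    proof -
      let ?p = "q(u := fst z, v := snd z)"
      have "edge_product E' F ?p = edge_product B F ?p * edge_product A F ?p"
        unfolding edge_product_def using fin(2) AB(1) B_def by (simp add: prod.subset_diff)
      also have "edge_product B F ?p = f (fst z)"
        unfolding edge_product_def f_def using B by (intro prod.cong) auto
      also have "edge_product A F ?p = g (snd z)"
        unfolding edge_product_def g_def using A by (intro prod.cong) auto
      finally have prod: "edge_product E' F ?p = f (fst z) * g (snd z)" .
      have "D (?p u, ?p v) = D z" using uv(3) by simp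
      thus ?thesis unfolding G_def prod by (simp only: mult.commute)
    qed
    thus ?thesis
      using product_weight_le_cut_norm[OF intD fg_meas(1) f_range fg_meas(2) g_range] by simp
  qed
  have "(\<integral>p. G p \<partial>unit_cube V) =
      (\<integral>q. (\<integral>z. G (q(u := fst z, v := snd z)) \<partial>unit_square) \<partial>unit_cube R)"
    unfolding R_def by (rule integral_split_pair[OF fin(1) uv G_meas G_bound])
  also have "\<bar>\<dots>\<bar> \<le> (\<integral>q. \<bar>\<integral>z. G (q(u := fst z, v := snd z)) \<partial>unit_square\<bar> \<partial>unit_cube R)"
    using integral_norm_bound[of "unit_cube R"
        "\<lambda>q. \<integral>z. G (q(u := fst z, v := snd z)) \<partial>unit_square"] by simp
  also have "\<dots> \<le> (\<integral>q. cut_norm D \<partial>unit_cube R)"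
    using inner cut_norm_nonneg[OF intD] by (intro integral_mono') auto
  also have "\<dots> = cut_norm D" by (simp add: R.prob_space)
  finally show ?thesis by (simp add: G_def E'_def)
qed

text \<open>Telescoping: the weights are exchanged one edge at a time. A single exchange leaves the
  difference of two weights on that edge, times a product of weights in the unit interval, and
  \<open>integral_edge_le_cut_norm\<close> bounds this by one cut norm.\<close>

lemma edge_product_cut_norm:
  assumes E: "simple_edges V E"
    and F: "\<And>e. e \<in> E \<Longrightarrow> F e \<in> borel_measurable unit_square"
      "\<And>e z. e \<in> E \<Longrightarrow> z \<in> space unit_square \<Longrightarrow> F e z \<in> {0..1}"
    and F': "\<And>e. e \<in> E \<Longrightarrow> F' e \<in> borel_measurable unit_square"
      "\<And>e z. e \<in> E \<Longrightarrow> z \<in> space unit_square \<Longrightarrow> F' e z \<in> {0..1}"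
  shows "\<bar>(\<integral>p. edge_product E F p \<partial>unit_cube V) - (\<integral>p. edge_product E F' p \<partial>unit_cube V)\<bar>
    \<le> (\<Sum>e\<in>E. cut_norm (\<lambda>z. F e z - F' e z))"
proof -
  \<comment> \<open>The edges in \<open>S\<close> are those already exchanged.\<close>
  define hybrid where "hybrid S e = (if e \<in> S then F' e else F e)" for S e
  have hyb: "hybrid S e \<in> borel_measurable unit_square"
      "z \<in> space unit_square \<Longrightarrow> hybrid S e z \<in> {0..1}" if "e \<in> E" for S e z
    using that F F' by (auto simp: hybrid_def)
  have sub: "E \<subseteq> V \<times> V" and fin: "finite E"
    using E simple_edges_finite[OF E] by (auto simp: simple_edges_def)
  have int: "integrable (unit_cube V) (edge_product E (hybrid S))" for S
    using hyb by (intro integrable_edge_product[OF sub]) fastforce+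
  have "\<bar>(\<integral>p. edge_product E F p \<partial>unit_cube V) - (\<integral>p. edge_product E (hybrid S) p \<partial>unit_cube V)\<bar>
      \<le> (\<Sum>e\<in>S. cut_norm (\<lambda>z. F e z - F' e z))" if "S \<subseteq> E" for S
    using finite_subset[OF that fin] that
  proof (induction S rule: finite_induct)
    case empty
    show ?case by (simp add: hybrid_def[abs_def])
  next
    case (insert e S)
    hence e: "e \<in> E" by simp
    obtain u v where uv: "e = (u, v)" by fastforce
    have same: "edge_product (E - {e}) (hybrid (insert e S)) p = edge_product (E - {e}) (hybrid S) p"
      for p unfolding edge_product_def by (intro prod.cong) (auto simp: hybrid_def)
    have "edge_product E (hybrid S) p - edge_product E (hybrid (insert e S)) p
        = (F e (p u, p v) - F' e (p u, p v)) * edge_product (E - {e}) (hybrid S) p" for p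
      unfolding edge_product_remove[OF fin e] same
      using insert(2) by (simp add: hybrid_def uv algebra_simps)
    hence "(\<integral>p. edge_product E (hybrid S) p \<partial>unit_cube V)
          - (\<integral>p. edge_product E (hybrid (insert e S)) p \<partial>unit_cube V)
        = (\<integral>p. (F e (p u, p v) - F' e (p u, p v)) * edge_product (E - {e}) (hybrid S) p \<partial>unit_cube V)"
      using int by (simp flip: Bochner_Integration.integral_diff)
    also have "\<bar>\<dots>\<bar> \<le> cut_norm (\<lambda>z. F e z - F' e z)"
    proof -
      have "\<bar>F e z - F' e z\<bar> \<le> 1" if "z \<in> space unit_square" for z
        using F(2)[OF e that] F'(2)[OF e that] by auto
      thus ?thesis
        using integral_edge_le_cut_norm[OF E e[unfolded uv], of "\<lambda>z. F e z - F' e z" "hybrid S"]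
          F(1)[OF e] F'(1)[OF e] hyb unfolding uv by auto
    qed
    finally show ?case using insert by simp
  qed
  from this[OF order_refl]
  have "\<bar>(\<integral>p. edge_product E F p \<partial>unit_cube V) - (\<integral>p. edge_product E (hybrid E) p \<partial>unit_cube V)\<bar>
      \<le> (\<Sum>e\<in>E. cut_norm (\<lambda>z. F e z - F' e z))" .
  moreover have "edge_product E (hybrid E) = edge_product E F'"
    unfolding edge_product_def[abs_def] by (intro ext prod.cong) (auto simp: hybrid_def)
  ultimately show ?thesis by simp
qed

text \<open>Rearranging each coordinate of the cube by the same map preserves the product
  measure.\<close>

lemma integral_edge_product_map_prod:
  assumes E: "simple_edges V E" and mp: "measure_preserving \<phi>"
    and F: "\<And>e. e \<in> E \<Longrightarrow> F e \<in> borel_measurable unit_square"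
  shows "(\<integral>p. edge_product E (\<lambda>e z. F e (map_prod \<phi> \<phi> z)) p \<partial>unit_cube V) =
    (\<integral>p. edge_product E F p \<partial>unit_cube V)"
proof -
  have sub: "E \<subseteq> V \<times> V" and fin: "finite V" using E by (auto simp: simple_edges_def)
  have \<phi>[measurable]: "\<phi> \<in> unit_interval \<rightarrow>\<^sub>M unit_interval"
    and distr: "distr unit_interval unit_interval \<phi> = unit_interval"
    using mp by (auto simp: measure_preserving_def)
  \<comment> \<open>Points of the product space are undefined outside \<open>V\<close>;
    \<open>compose V\<close> keeps them so, unlike plain composition.\<close>
  have "distr (unit_cube V) (unit_cube V) (compose V \<phi>)
      = (\<Pi>\<^sub>M v\<in>V. distr unit_interval unit_interval \<phi>)"
    using fin by (intro distr_PiM_finite_prob_space' unit_interval.prob_space_axioms \<phi>)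
  hence distr': "distr (unit_cube V) (unit_cube V) (compose V \<phi>) = unit_cube V"
    by (simp add: distr)
  have "compose V \<phi> \<in> unit_cube V \<rightarrow>\<^sub>M unit_cube V"
    unfolding compose_def
    by (intro measurable_restrict measurable_compose[OF _ \<phi>] measurable_component_singleton)
  from integral_distr[OF this measurable_edge_product[OF sub F]]
  have "(\<integral>p. edge_product E F p \<partial>unit_cube V) = (\<integral>p. edge_product E F (compose V \<phi> p) \<partial>unit_cube V)"
    by (simp add: distr')
  moreover have "edge_product E F (compose V \<phi> p) = edge_product E (\<lambda>e z. F e (map_prod \<phi> \<phi> z)) p" for p
    unfolding edge_product_def using sub
    by (intro prod.cong) (auto simp: compose_def mem_Times_iff subset_iff)
  ultimately show ?thesis by simp
qed

section \<open>Invariance of the free energy, and maximizers as representatives\<close>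

lemma hom_density_eq:
  "hom_density H W =
    (\<integral>p. edge_product (edges H) (\<lambda>e. W (color H e)) p \<partial>unit_cube (verts H))"
  by (simp add: hom_density_def edge_product_def case_prod_unfold)

lemma simple_colored_graph_edges:
  assumes "simple_colored_graph k H"
  shows "simple_edges (verts H) (edges H)"
  using assms by (simp add: simple_colored_graph_def simple_edges_def)

lemma simple_colored_graph_color:
  "simple_colored_graph k H \<Longrightarrow> e \<in> edges H \<Longrightarrow> color H e \<in> {1..k}"
  unfolding simple_colored_graph_def by blast

text \<open>The density of \<open>W\<close> does not change under the maps, so the difference of the
  densities is a constant bounded by a null sequence.\<close>

lemma hom_density_cut_distance_zero:
  assumes H: "simple_colored_graph k H"
    and UW: "U \<in> graphons k" "W \<in> graphons k" "cut_distance k U W = 0"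
  shows "hom_density H U = hom_density H W"
proof -
  obtain \<phi> :: "nat \<Rightarrow> real \<Rightarrow> real" where mp: "\<And>n. measure_preserving (\<phi> n)" and
    lim: "\<And>a. a \<in> {1..k} \<Longrightarrow> (\<lambda>n. cut_norm (\<lambda>z. U a z - W a (map_prod (\<phi> n) (\<phi> n) z))) \<longlonglongrightarrow> 0"
    using cut_distance_zero_sequence[OF UW] by blast
  note E = simple_colored_graph_edges[OF H] and col = simple_colored_graph_color[OF H]
  note U = measurable_graphon[OF UW(1) col] graphon_range[OF UW(1) col]
  note W = measurable_graphon[OF UW(2) col] graphon_range[OF UW(2) col]
  have le: "\<bar>hom_density H U - hom_density H W\<bar>
      \<le> (\<Sum>e\<in>edges H. cut_norm (\<lambda>z. U (color H e) z - W (color H e) (map_prod (\<phi> n) (\<phi> n) z)))" for n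
  proof -
    note \<Phi> = measurable_map_prod[OF mp[of n]]
    have "hom_density H W = (\<integral>p. edge_product (edges H)
        (\<lambda>e z. W (color H e) (map_prod (\<phi> n) (\<phi> n) z)) p \<partial>unit_cube (verts H))"
      using integral_edge_product_map_prod[OF E mp[of n] W(1)] by (simp add: hom_density_eq)
    thus ?thesis unfolding hom_density_eq[of H U]
      using measurable_compose[OF \<Phi> W(1)] W(2)[OF _ measurable_space[OF \<Phi>]]
      by (simp only:) (rule edge_product_cut_norm[OF E U]; assumption)
  qed
  have "(\<lambda>n. \<Sum>e\<in>edges H. cut_norm (\<lambda>z. U (color H e) z - W (color H e) (map_prod (\<phi> n) (\<phi> n) z)))
      \<longlonglongrightarrow> (\<Sum>e\<in>edges H. 0)"
    by (intro tendsto_sum lim col)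
  hence "\<bar>hom_density H U - hom_density H W\<bar> \<le> (\<Sum>e\<in>edges H. 0)"
    by (rule LIMSEQ_le_const) (use le in blast)
  thus ?thesis by simp
qed

lemma free_energy_cut_distance_zero:
  assumes "\<And>s. s \<in> {1..r} \<Longrightarrow> simple_colored_graph k (H s)"
    and "U \<in> graphons k" "W \<in> graphons k" "cut_distance k U W = 0"
  shows "free_energy k r \<beta> H U = free_energy k r \<beta> H W"
  unfolding free_energy_def entropy_functional_cut_distance_zero[OF assms(2-4)]
  using hom_density_cut_distance_zero[OF assms(1) assms(2-4)] by simp

text \<open>Reflexivity puts a graphon into its own class, and invariance of the free energy
  collapses the image of that class to one value. Thus the maximality of \<open>C\<close> turns into
  an inequality against every single graphon.\<close>

lemma maximizing_class_representative:
  assumes H: "\<And>s. s \<in> {1..r} \<Longrightarrow> simple_colored_graph k (H s)"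
    and max: "is_arg_max (free_energy_class k r \<beta> H) (\<lambda>D. D \<in> graphon_classes k) C"
    and W: "W \<in> C"
  shows "W \<in> graphons k"
    and "V \<in> graphons k \<Longrightarrow> free_energy k r \<beta> H V \<le> free_energy k r \<beta> H W"
proof -
  define rel where
    "rel = {(U, W). U \<in> graphons k \<and> W \<in> graphons k \<and> cut_distance k U W = 0}"
  have class_value: "free_energy_class k r \<beta> H (rel `` {U}) = free_energy k r \<beta> H U"
    if U: "U \<in> graphons k" for U
  proof -
    have "free_energy k r \<beta> H ` (rel `` {U}) = {free_energy k r \<beta> H U}"
    proof (intro equalityI subsetI)
      fix x assume "x \<in> free_energy k r \<beta> H ` (rel `` {U})"
      then obtain V where V: "x = free_energy k r \<beta> H V" "V \<in> graphons k" "cut_distance k U V = 0"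
        unfolding rel_def by blast
      thus "x \<in> {free_energy k r \<beta> H U}"
        using free_energy_cut_distance_zero[OF H U V(2,3)] by simp
    next
      fix x assume "x \<in> {free_energy k r \<beta> H U}"
      thus "x \<in> free_energy k r \<beta> H ` (rel `` {U})"
        using cut_distance_self[OF U] U unfolding rel_def by blast
    qed
    thus ?thesis by (simp add: free_energy_class_def)
  qed
  have "C \<in> graphon_classes k" using max by (simp add: is_arg_max_def)
  then obtain U where U: "U \<in> graphons k" "C = rel `` {U}"
    unfolding graphon_classes_def rel_def[symmetric] quotient_def by blast
  hence UW: "(U, W) \<in> rel" using W by simp
  thus W': "W \<in> graphons k" by (simp add: rel_def)
  have "free_energy_class k r \<beta> H C = free_energy k r \<beta> H W"
    using class_value[OF U(1)] free_energy_cut_distance_zero[OF H U(1) W', where \<beta> = \<beta>] UW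
    by (simp add: U(2) rel_def)
  moreover assume V: "V \<in> graphons k"
  hence "rel `` {V} \<in> graphon_classes k"
    unfolding graphon_classes_def rel_def[symmetric] by (rule quotientI)
  hence "\<not> free_energy_class k r \<beta> H C < free_energy_class k r \<beta> H (rel `` {V})"
    using max by (simp add: is_arg_max_def)
  ultimately show "free_energy k r \<beta> H V \<le> free_energy k r \<beta> H W"
    using class_value[OF V] by simp
qed

section \<open>The variational argument\<close>

text \<open>A new factor multiplies the old remainder by \<open>w x + \<tau> * d x\<close>, of
  modulus at most 1, and adds \<tau> squared times \<open>d x * S\<close>, where \<open>S\<close>
  has at most \<open>card E\<close> terms of modulus at most 1. The constant is quadratic because
  \<open>n + n * n\<close> is at most the square of \<open>n + 1\<close>.\<close>

lemma prod_expansion_bound: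
  fixes w d :: "'e \<Rightarrow> real"
  assumes "finite E" and "\<And>e. e \<in> E \<Longrightarrow> \<bar>w e\<bar> \<le> 1" "\<And>e. e \<in> E \<Longrightarrow> \<bar>d e\<bar> \<le> 1"
    "\<And>e. e \<in> E \<Longrightarrow> \<bar>w e + \<tau> * d e\<bar> \<le> 1"
  shows "\<bar>(\<Prod>e\<in>E. w e + \<tau> * d e) - (\<Prod>e\<in>E. w e) - \<tau> * (\<Sum>e\<in>E. d e * (\<Prod>i\<in>E - {e}. w i))\<bar>
    \<le> (real (card E))\<^sup>2 * \<tau>\<^sup>2"
  using assms
proof (induction E rule: finite_induct)
  case (insert x E)
  define P where "P = (\<Prod>e\<in>E. w e + \<tau> * d e)"
  define P0 where "P0 = (\<Prod>e\<in>E. w e)"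
  define S where "S = (\<Sum>e\<in>E. d e * (\<Prod>i\<in>E - {e}. w i))"
  define R where "R = P - P0 - \<tau> * S"
  have R: "\<bar>R\<bar> \<le> (real (card E))\<^sup>2 * \<tau>\<^sup>2"
    unfolding R_def P_def P0_def S_def using insert.prems by (intro insert.IH) auto
  have "\<bar>d e * (\<Prod>i\<in>E - {e}. w i)\<bar> \<le> 1" if "e \<in> E" for e
    unfolding abs_mult abs_prod using that insert.prems
    by (intro mult_le_one prod_le_1 prod_nonneg) auto
  hence "(\<Sum>e\<in>E. \<bar>d e * (\<Prod>i\<in>E - {e}. w i)\<bar>) \<le> (\<Sum>e\<in>E. 1)" by (intro sum_mono)
  hence S: "\<bar>S\<bar> \<le> real (card E)"
    unfolding S_def by (intro order_trans[OF sum_abs]) simp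
  have "(\<Prod>i\<in>insert x E - {e}. w i) = w x * (\<Prod>i\<in>E - {e}. w i)" if "e \<in> E" for e
  proof -
    have "insert x E - {e} = insert x (E - {e})" using that insert.hyps by auto
    thus ?thesis using insert.hyps by simp
  qed
  hence "(\<Sum>e\<in>E. d e * (\<Prod>i\<in>insert x E - {e}. w i)) = w x * S"
    unfolding S_def sum_distrib_left by (intro sum.cong) auto
  moreover have "insert x E - {x} = E" using insert.hyps by auto
  ultimately have sum: "(\<Sum>e\<in>insert x E. d e * (\<Prod>i\<in>insert x E - {e}. w i)) = d x * P0 + w x * S"
    using insert.hyps by (simp add: P0_def)
  have "(\<Prod>e\<in>insert x E. w e + \<tau> * d e) - (\<Prod>e\<in>insert x E. w e)
      - \<tau> * (\<Sum>e\<in>insert x E. d e * (\<Prod>i\<in>insert x E - {e}. w i))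
      = (w x + \<tau> * d x) * P - w x * P0 - \<tau> * (d x * P0 + w x * S)"
    unfolding sum using insert.hyps by (simp add: P_def P0_def)
  also have "\<dots> = \<tau>\<^sup>2 * (d x * S) + (w x + \<tau> * d x) * R"
    by (simp add: R_def power2_eq_square algebra_simps)
  also have "\<bar>\<dots>\<bar> \<le> \<tau>\<^sup>2 * (1 * real (card E)) + 1 * ((real (card E))\<^sup>2 * \<tau>\<^sup>2)"
  proof (rule order_trans[OF abs_triangle_ineq add_mono])
    show "\<bar>\<tau>\<^sup>2 * (d x * S)\<bar> \<le> \<tau>\<^sup>2 * (1 * real (card E))"
      using S insert.prems unfolding abs_mult by (intro mult_mono) auto
    show "\<bar>(w x + \<tau> * d x) * R\<bar> \<le> 1 * ((real (card E))\<^sup>2 * \<tau>\<^sup>2)"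
      using R insert.prems unfolding abs_mult by (intro mult_mono) auto
  qed
  also have "\<dots> \<le> (real (card (insert x E)))\<^sup>2 * \<tau>\<^sup>2"
  proof -
    have "real (card E) + (real (card E))\<^sup>2 \<le> (real (card (insert x E)))\<^sup>2"
      using insert.hyps by (simp add: power2_eq_square algebra_simps)
    from mult_right_mono[OF this, of "\<tau>\<^sup>2"] show ?thesis by (simp add: algebra_simps)
  qed
  finally show ?case .
qed simp

text \<open>The contribution of one edge to \<open>edge_delta\<close>, before its colour is tested:
  the mean of all other factors given the positions of the two endpoints.\<close>

definition edge_marginal ::
  "'v set \<Rightarrow> ('v \<times> 'v) set \<Rightarrow> ('v \<times> 'v \<Rightarrow> real \<times> real \<Rightarrow> real) \<Rightarrow> 'v \<times> 'v \<Rightarrow> real \<times> real \<Rightarrow> real"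
where
  "edge_marginal V E F e z =
     (\<integral>q. edge_product (E - {e}) F (q(fst e := fst z, snd e := snd z)) \<partial>unit_cube (V - {fst e, snd e}))"

text \<open>The integral identity is the reason for the definition: perturbing the weight of
  \<open>e\<close> alone by \<open>D\<close> acts on the density as pairing \<open>D\<close> with
  this kernel. It holds because \<open>D\<close> depends on the two endpoint coordinates only and
  leaves the inner integral as a factor.\<close>

lemma
  assumes E: "simple_edges V E" "e \<in> E"
    and F: "\<And>e. e \<in> E \<Longrightarrow> F e \<in> borel_measurable unit_square"
      "\<And>e z. e \<in> E \<Longrightarrow> z \<in> space unit_square \<Longrightarrow> \<bar>F e z\<bar> \<le> 1"
  shows measurable_edge_marginal: "edge_marginal V E F e \<in> borel_measurable unit_square"
    and abs_edge_marginal_le: "z \<in> space unit_square \<Longrightarrow> \<bar>edge_marginal V E F e z\<bar> \<le> 1"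
    and integral_edge_marginal:
      "D \<in> borel_measurable unit_square \<Longrightarrow> (\<And>z. z \<in> space unit_square \<Longrightarrow> \<bar>D z\<bar> \<le> 1) \<Longrightarrow>
       (\<integral>p. D (p (fst e), p (snd e)) * edge_product (E - {e}) F p \<partial>unit_cube V) =
       (\<integral>z. D z * edge_marginal V E F e z \<partial>unit_square)"
proof -
  obtain u v where uv: "e = (u, v)" by fastforce
  define R where "R = V - {u, v}"
  interpret R: prob_space "unit_cube R" by (rule prob_space_unit_cube)
  have V: "finite V" "u \<in> V" "v \<in> V" "u \<noteq> v" and sub: "E - {e} \<subseteq> V \<times> V"
    using E uv by (auto simp: simple_edges_def)
  have G: "edge_product (E - {e}) F \<in> borel_measurable (unit_cube V)"
    using F(1) by (intro measurable_edge_product[OF sub]) auto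
  have G_le: "\<bar>edge_product (E - {e}) F p\<bar> \<le> 1" if "p \<in> space (unit_cube V)" for p
    using F(2) by (intro abs_edge_product_le[OF sub that]) auto
  have pair: "(\<lambda>(z, q). edge_product (E - {e}) F (q(u := fst z, v := snd z)))
      \<in> borel_measurable (unit_square \<Otimes>\<^sub>M unit_cube R)"
    using measurable_compose[OF measurable_pair_swap'
        measurable_compose[OF measurable_insert_pair[OF V(2-4)] G]]
    by (simp add: R_def case_prod_unfold)
  thus "edge_marginal V E F e \<in> borel_measurable unit_square"
    unfolding edge_marginal_def[abs_def] uv fst_conv snd_conv R_def[symmetric]
    by (intro R.borel_measurable_lebesgue_integral) (simp add: uv)
  show "\<bar>edge_marginal V E F e z\<bar> \<le> 1" if z: "z \<in> space unit_square"
  proof -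
    have le: "\<bar>edge_product (E - {e}) F (q(u := fst z, v := snd z))\<bar> \<le> 1"
      if "q \<in> space (unit_cube R)" for q
      using measurable_space[OF measurable_insert_pair[OF V(2-4)], of "(q, z)"] that z
      by (intro G_le) (auto simp: space_pair_measure R_def)
    have "\<bar>edge_marginal V E F e z\<bar>
        \<le> (\<integral>q. \<bar>edge_product (E - {e}) F (q(u := fst z, v := snd z))\<bar> \<partial>unit_cube R)"
      unfolding edge_marginal_def uv fst_conv snd_conv R_def[symmetric]
      using integral_norm_bound[of "unit_cube R"] by fastforce
    also have "\<dots> \<le> (\<integral>q. 1 \<partial>unit_cube R)"
      using le by (intro integral_mono') auto
    finally show ?thesis by (simp add: R.prob_space)
  qed
  assume D: "D \<in> borel_measurable unit_square" "\<And>z. z \<in> space unit_square \<Longrightarrow> \<bar>D z\<bar> \<le> 1"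
  have "(\<integral>p. D (p u, p v) * edge_product (E - {e}) F p \<partial>unit_cube V) =
      (\<integral>z. (\<integral>q. D ((q(u := fst z, v := snd z)) u, (q(u := fst z, v := snd z)) v)
        * edge_product (E - {e}) F (q(u := fst z, v := snd z)) \<partial>unit_cube R) \<partial>unit_square)"
    unfolding R_def
  proof (rule integral_split_pair_swap[OF V, where B = 1])
    show "(\<lambda>p. D (p u, p v) * edge_product (E - {e}) F p) \<in> borel_measurable (unit_cube V)"
      by (intro borel_measurable_times measurable_compose[OF measurable_pair_coordinates D(1)] G V)
    fix p assume p: "p \<in> space (unit_cube V)"
    show "\<bar>D (p u, p v) * edge_product (E - {e}) F p\<bar> \<le> 1"
      unfolding abs_mult using D(2)[OF coordinates_in_square[OF p V(2,3)]] G_le[OF p]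
      by (intro mult_le_one) auto
  qed
  also have "\<dots> = (\<integral>z. D z * edge_marginal V E F e z \<partial>unit_square)"
  proof (intro Bochner_Integration.integral_cong refl)
    fix z
    have "D ((q(u := fst z, v := snd z)) u, (q(u := fst z, v := snd z)) v) = D z" for q :: "'a \<Rightarrow> real"
      using V(4) by simp
    thus "(\<integral>q. D ((q(u := fst z, v := snd z)) u, (q(u := fst z, v := snd z)) v)
        * edge_product (E - {e}) F (q(u := fst z, v := snd z)) \<partial>unit_cube R)
        = D z * edge_marginal V E F e z"
      unfolding edge_marginal_def by (simp only: uv fst_conv snd_conv R_def integral_mult_right_zero)
  qed
  finally show "(\<integral>p. D (p (fst e), p (snd e)) * edge_product (E - {e}) F p \<partial>unit_cube V) =
       (\<integral>z. D z * edge_marginal V E F e z \<partial>unit_square)"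
    by (simp add: uv)
qed

lemma edge_delta_eq:
  "edge_delta H a W z = (\<Sum>e\<in>edges H. of_bool (color H e = a) *
     edge_marginal (verts H) (edges H) (\<lambda>e. W (color H e)) e z)"
  by (simp add: edge_delta_def edge_marginal_def edge_product_def case_prod_unfold Let_def)

lemma graphon_edge_functions:
  assumes "simple_colored_graph k H" "W \<in> graphons k" "e \<in> edges H"
  shows "W (color H e) \<in> borel_measurable unit_square"
    and "z \<in> space unit_square \<Longrightarrow> \<bar>W (color H e) z\<bar> \<le> 1"
  using measurable_graphon[OF assms(2) simple_colored_graph_color[OF assms(1,3)]]
    graphon_range[OF assms(2) simple_colored_graph_color[OF assms(1,3)], of z] by auto

lemma
  assumes H: "simple_colored_graph k H" and W: "W \<in> graphons k"
  shows measurable_edge_delta: "edge_delta H a W \<in> borel_measurable unit_square"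
    and abs_edge_delta_le:
      "z \<in> space unit_square \<Longrightarrow> \<bar>edge_delta H a W z\<bar> \<le> real (card (edges H))"
proof -
  note E = simple_colored_graph_edges[OF H]
  note F = graphon_edge_functions[OF H W]
  show "edge_delta H a W \<in> borel_measurable unit_square"
    unfolding edge_delta_eq[abs_def]
    by (intro borel_measurable_sum borel_measurable_times borel_measurable_const
        measurable_edge_marginal[OF E] F)
  assume z: "z \<in> space unit_square"
  have "\<bar>edge_delta H a W z\<bar> \<le> (\<Sum>e\<in>edges H. \<bar>of_bool (color H e = a) *
      edge_marginal (verts H) (edges H) (\<lambda>e. W (color H e)) e z\<bar>)"
    unfolding edge_delta_eq by (rule sum_abs)
  also have "\<dots> \<le> (\<Sum>e\<in>edges H. 1)"
  proof (rule sum_mono)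
    fix e assume "e \<in> edges H"
    thus "\<bar>of_bool (color H e = a) * edge_marginal (verts H) (edges H) (\<lambda>e. W (color H e)) e z\<bar> \<le> 1"
      using abs_edge_marginal_le[OF E _ F z] by (simp add: abs_mult)
  qed
  finally show "\<bar>edge_delta H a W z\<bar> \<le> real (card (edges H))" by simp
qed

lemma sym_edge_delta_eq:
  "sym_edge_delta H a W z = 1 / 2 * (edge_delta H a W z + edge_delta H a W (prod.swap z))"
  by (simp add: sym_edge_delta_def case_prod_unfold prod.swap_def)

lemma sym_edge_delta_swap: "sym_edge_delta H a W (prod.swap z) = sym_edge_delta H a W z"
  by (simp add: sym_edge_delta_eq)

lemma measurable_swap_square: "prod.swap \<in> unit_square \<rightarrow>\<^sub>M unit_square"
proof -
  have "prod.swap = (\<lambda>(x, y). (y :: real, x :: real))" by (auto simp: fun_eq_iff)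
  thus ?thesis
    using measurable_pair_swap'[of unit_interval unit_interval] by (simp add: unit_square_def)
qed

lemma integral_swap_square:
  fixes f :: "real \<times> real \<Rightarrow> real"
  assumes "f \<in> borel_measurable unit_square"
  shows "(\<integral>z. f (prod.swap z) \<partial>unit_square) = (\<integral>z. f z \<partial>unit_square)"
  using unit_interval_pair.integral_product_swap[of f] assms
  by (simp add: unit_square_def prod.swap_def case_prod_unfold)

lemma
  assumes H: "simple_colored_graph k H" and W: "W \<in> graphons k"
  shows measurable_sym_edge_delta: "sym_edge_delta H a W \<in> borel_measurable unit_square"
    and abs_sym_edge_delta_le:
      "z \<in> space unit_square \<Longrightarrow> \<bar>sym_edge_delta H a W z\<bar> \<le> real (card (edges H))"
proof -
  note meas = measurable_edge_delta[OF H W, of a]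
  show "sym_edge_delta H a W \<in> borel_measurable unit_square"
    unfolding sym_edge_delta_eq[abs_def]
    by (intro borel_measurable_times borel_measurable_add borel_measurable_const meas
        measurable_compose[OF measurable_swap_square meas])
  assume z: "z \<in> space unit_square"
  show "\<bar>sym_edge_delta H a W z\<bar> \<le> real (card (edges H))"
    using abs_edge_delta_le[OF H W z, of a]
      abs_edge_delta_le[OF H W measurable_space[OF measurable_swap_square z], of a]
      abs_triangle_ineq[of "edge_delta H a W z" "edge_delta H a W (prod.swap z)"]
    by (simp add: sym_edge_delta_eq abs_mult)
qed

lemma integrable_times_bounded:
  fixes f g :: "real \<times> real \<Rightarrow> real"
  assumes "f \<in> borel_measurable unit_square" "\<And>z. z \<in> space unit_square \<Longrightarrow> \<bar>f z\<bar> \<le> B"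
    and "g \<in> borel_measurable unit_square" "\<And>z. z \<in> space unit_square \<Longrightarrow> \<bar>g z\<bar> \<le> C"
  shows "integrable unit_square (\<lambda>z. f z * g z)"
proof (rule unit_square.integrable_bounded[where B = "B * C"])
  fix z assume z: "z \<in> space unit_square"
  show "\<bar>f z * g z\<bar> \<le> B * C"
    unfolding abs_mult using assms(2)[OF z] assms(4)[OF z] by (intro mult_mono) auto
qed (use assms in measurable)

text \<open>The swap preserves the measure and \<open>D\<close>, so a symmetric direction cannot
  distinguish a kernel from its reflection, nor from the average of the two. The orientation chosen
  for the edges thus drops out.\<close>

lemma integral_sym_edge_delta:
  assumes H: "simple_colored_graph k H" and W: "W \<in> graphons k"
    and D: "D \<in> borel_measurable unit_square" "\<And>z. z \<in> space unit_square \<Longrightarrow> \<bar>D z\<bar> \<le> 1"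
      "\<And>z. z \<in> space unit_square \<Longrightarrow> D (prod.swap z) = D z"
  shows "(\<integral>z. D z * edge_delta H a W z \<partial>unit_square) =
    (\<integral>z. D z * sym_edge_delta H a W z \<partial>unit_square)"
proof -
  note meas = measurable_edge_delta[OF H W, of a]
  note int = integrable_times_bounded[OF D(1,2) meas abs_edge_delta_le[OF H W]]
  have int': "integrable unit_square (\<lambda>z. D z * edge_delta H a W (prod.swap z))"
    by (rule integrable_times_bounded[OF D(1,2) measurable_compose[OF measurable_swap_square meas]
          abs_edge_delta_le[OF H W measurable_space[OF measurable_swap_square]]])
  have "(\<integral>z. D z * edge_delta H a W z \<partial>unit_square)
      = (\<integral>z. D (prod.swap z) * edge_delta H a W (prod.swap z) \<partial>unit_square)"
    using integral_swap_square[OF borel_measurable_integrable[OF int]] by simp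
  also have "\<dots> = (\<integral>z. D z * edge_delta H a W (prod.swap z) \<partial>unit_square)"
    using D(3) by (intro Bochner_Integration.integral_cong) auto
  finally have "(\<integral>z. D z * edge_delta H a W z \<partial>unit_square)
      = 1 / 2 * (\<integral>z. D z * edge_delta H a W z + D z * edge_delta H a W (prod.swap z) \<partial>unit_square)"
    using int int' by simp
  also have "\<dots> = (\<integral>z. D z * sym_edge_delta H a W z \<partial>unit_square)"
    unfolding Bochner_Integration.integral_mult_right_zero[symmetric] sym_edge_delta_eq
    by (intro Bochner_Integration.integral_cong) (auto simp: algebra_simps)
  finally show ?thesis .
qed

text \<open>The functions \<open>edge_delta H a W\<close> are the components of the derivative of
  the density at \<open>W\<close>. The remainder depends on the graph and on \<tau> only, which
  permits the limit of small \<tau> for fixed \<open>P\<close>.\<close>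

lemma hom_density_expansion:
  assumes H: "simple_colored_graph k H" and W: "W \<in> graphons k" and P: "P \<in> graphons k"
    and \<tau>: "\<tau> \<in> {0..1}"
  shows "\<bar>hom_density H (\<lambda>a z. W a z + \<tau> * (P a z - W a z)) - hom_density H W
      - \<tau> * (\<Sum>a=1..k. \<integral>z. (P a z - W a z) * edge_delta H a W z \<partial>unit_square)\<bar>
    \<le> (real (card (edges H)))\<^sup>2 * \<tau>\<^sup>2"
proof -
  define V where "V = verts H"
  define E where "E = edges H"
  define F where "F e = W (color H e)" for e
  define D where "D e z = P (color H e) z - W (color H e) z" for e z
  interpret V: prob_space "unit_cube V" by (rule prob_space_unit_cube)
  have E: "simple_edges V E" and fin: "finite E" and sub: "E \<subseteq> V \<times> V"
    using simple_colored_graph_edges[OF H] simple_edges_finite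
    by (auto simp: V_def E_def simple_edges_def)
  have col: "color H e \<in> {1..k}" if "e \<in> E" for e
    using simple_colored_graph_color[OF H] that by (simp add: E_def)
  have F: "F e \<in> borel_measurable unit_square" "z \<in> space unit_square \<Longrightarrow> \<bar>F e z\<bar> \<le> 1"
    if "e \<in> E" for e z
    using graphon_edge_functions[OF H W] that by (auto simp: F_def E_def)
  have D: "D e \<in> borel_measurable unit_square" if "e \<in> E" for e
    unfolding D_def using measurable_graphon[OF W col[OF that]] measurable_graphon[OF P col[OF that]]
    by measurable
  have D_le: "\<bar>D e z\<bar> \<le> 1" and FD_le: "\<bar>F e z + \<tau> * D e z\<bar> \<le> 1"
    if "e \<in> E" "z \<in> space unit_square" for e z
  proof -
    have r: "F e z \<in> {0..1}" "P (color H e) z \<in> {0..1}"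
      using graphon_range[OF W col[OF that(1)] that(2)] graphon_range[OF P col[OF that(1)] that(2)]
      by (auto simp: F_def)
    thus "\<bar>D e z\<bar> \<le> 1" by (auto simp: D_def F_def)
    \<comment> \<open>The perturbed weight is a convex combination, so it stays in the unit
      interval.\<close>
    have "F e z + \<tau> * D e z = (1 - \<tau>) * F e z + \<tau> * P (color H e) z"
      by (simp add: D_def F_def algebra_simps)
    moreover have "0 \<le> (1 - \<tau>) * F e z + \<tau> * P (color H e) z" using r \<tau> by simp
    moreover have "(1 - \<tau>) * F e z + \<tau> * P (color H e) z \<le> 1"
      using r \<tau> by (intro convex_bound_le) auto
    ultimately show "\<bar>F e z + \<tau> * D e z\<bar> \<le> 1" by simp
  qed
  define T where "T = (\<lambda>p. edge_product E (\<lambda>e z. F e z + \<tau> * D e z) p)"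
  define T0 where "T0 = (\<lambda>p. edge_product E F p)"
  define L where "L = (\<lambda>e p. D e (p (fst e), p (snd e)) * edge_product (E - {e}) F p)"
  have FD: "(\<lambda>z. F e z + \<tau> * D e z) \<in> borel_measurable unit_square" if "e \<in> E" for e
    using F(1)[OF that] D[OF that] by measurable
  have int: "integrable (unit_cube V) T" "integrable (unit_cube V) T0"
    unfolding T_def T0_def by (intro integrable_edge_product[OF sub] F FD FD_le; assumption)+
  have inside: "(p (fst e), p (snd e)) \<in> space unit_square"
    if "e \<in> E" "p \<in> space (unit_cube V)" for e p
    using that sub by (intro coordinates_in_square) (auto simp: mem_Times_iff)
  have int_L: "integrable (unit_cube V) (L e)" if e: "e \<in> E" for e
  proof (rule V.integrable_bounded[where B = 1])
    have eV: "fst e \<in> V" "snd e \<in> V" using e sub by (auto simp: mem_Times_iff)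
    have sub': "E - {e} \<subseteq> V \<times> V" using sub by blast
    show "L e \<in> borel_measurable (unit_cube V)" unfolding L_def using F(1)
      by (intro borel_measurable_times measurable_compose[OF measurable_pair_coordinates D[OF e]]
          measurable_edge_product[OF sub'] eV) auto
    fix p assume p: "p \<in> space (unit_cube V)"
    have "\<bar>edge_product (E - {e}) F p\<bar> \<le> 1"
      using F(2) by (intro abs_edge_product_le[OF sub' p]) auto
    thus "\<bar>L e p\<bar> \<le> 1"
      unfolding L_def abs_mult using D_le[OF e inside[OF e p]] by (intro mult_le_one) auto
  qed
  have pointwise: "\<bar>T p - T0 p - \<tau> * (\<Sum>e\<in>E. L e p)\<bar> \<le> (real (card E))\<^sup>2 * \<tau>\<^sup>2"
    if p: "p \<in> space (unit_cube V)" for p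
    unfolding T_def T0_def L_def edge_product_def
    using F(2)[OF _ inside[OF _ p]] D_le[OF _ inside[OF _ p]] FD_le[OF _ inside[OF _ p]]
    by (intro prod_expansion_bound[OF fin])
  have int_diff: "integrable (unit_cube V) (\<lambda>p. T p - T0 p - \<tau> * (\<Sum>e\<in>E. L e p))"
    using int int_L by auto
  have "(\<Sum>e\<in>E. \<integral>p. L e p \<partial>unit_cube V)
      = (\<Sum>e\<in>E. \<integral>z. D e z * edge_marginal V E F e z \<partial>unit_square)"
    unfolding L_def by (intro sum.cong refl integral_edge_marginal[OF E] F D D_le)
  \<comment> \<open>Exactly one colour in \<open>{1..k}\<close> is that of \<open>e\<close>, so the
    inserted sum has a single nonzero candidate. Exchanging the sums then groups the edges by
    colour.\<close>
  also have "\<dots> = (\<Sum>e\<in>E. \<Sum>a=1..k. of_bool (color H e = a) *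
      (\<integral>z. (P a z - W a z) * edge_marginal V E F e z \<partial>unit_square))"
  proof (intro sum.cong refl)
    fix e assume "e \<in> E"
    thus "(\<integral>z. D e z * edge_marginal V E F e z \<partial>unit_square) = (\<Sum>a=1..k. of_bool (color H e = a) *
        (\<integral>z. (P a z - W a z) * edge_marginal V E F e z \<partial>unit_square))"
      using col[of e] by (simp add: D_def of_bool_def if_distrib[of "\<lambda>x. x * _"] cong: if_cong)
  qed
  also have "\<dots> = (\<Sum>a=1..k. \<Sum>e\<in>E. of_bool (color H e = a) *
      (\<integral>z. (P a z - W a z) * edge_marginal V E F e z \<partial>unit_square))"
    by (rule sum.swap)
  also have "\<dots> = (\<Sum>a=1..k. \<integral>z. (P a z - W a z) * edge_delta H a W z \<partial>unit_square)"
  proof (rule sum.cong[OF refl])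
    fix a assume a: "a \<in> {1..k}"
    have D_a: "(\<lambda>z. P a z - W a z) \<in> borel_measurable unit_square"
      using measurable_graphon[OF W a] measurable_graphon[OF P a] by measurable
    have D_a_le: "\<bar>P a z - W a z\<bar> \<le> 1" if "z \<in> space unit_square" for z
      using graphon_range[OF W a that] graphon_range[OF P a that] by auto
    have int_M: "integrable unit_square (\<lambda>z. (P a z - W a z) * edge_marginal V E F e z)"
      if "e \<in> E" for e
      by (rule integrable_times_bounded[OF D_a D_a_le, where C = 1])
        (use F in \<open>auto intro!: measurable_edge_marginal[OF E that] abs_edge_marginal_le[OF E that]\<close>)
    have "(\<integral>z. (P a z - W a z) * edge_delta H a W z \<partial>unit_square)
        = (\<integral>z. (\<Sum>e\<in>E. of_bool (color H e = a) *
            ((P a z - W a z) * edge_marginal V E F e z)) \<partial>unit_square)"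
      unfolding edge_delta_eq V_def E_def F_def[abs_def] sum_distrib_left
      by (simp only: mult.left_commute)
    also have "\<dots> = (\<Sum>e\<in>E. of_bool (color H e = a) *
        (\<integral>z. (P a z - W a z) * edge_marginal V E F e z \<partial>unit_square))"
      using int_M by (subst Bochner_Integration.integral_sum) auto
    finally show "(\<Sum>e\<in>E. of_bool (color H e = a) *
        (\<integral>z. (P a z - W a z) * edge_marginal V E F e z \<partial>unit_square))
      = (\<integral>z. (P a z - W a z) * edge_delta H a W z \<partial>unit_square)" by simp
  qed
  finally have lin: "(\<integral>p. (\<Sum>e\<in>E. L e p) \<partial>unit_cube V)
      = (\<Sum>a=1..k. \<integral>z. (P a z - W a z) * edge_delta H a W z \<partial>unit_square)"
    using int_L by (simp add: Bochner_Integration.integral_sum)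
  have dens: "hom_density H W = (\<integral>p. T0 p \<partial>unit_cube V)"
    "hom_density H (\<lambda>a z. W a z + \<tau> * (P a z - W a z)) = (\<integral>p. T p \<partial>unit_cube V)"
    by (simp_all add: hom_density_eq T0_def T_def F_def[abs_def] D_def E_def V_def)
  have "hom_density H (\<lambda>a z. W a z + \<tau> * (P a z - W a z)) - hom_density H W
      - \<tau> * (\<Sum>a=1..k. \<integral>z. (P a z - W a z) * edge_delta H a W z \<partial>unit_square)
      = (\<integral>p. T p - T0 p - \<tau> * (\<Sum>e\<in>E. L e p) \<partial>unit_cube V)"
    unfolding dens lin[symmetric] using int int_L by simp
  also have "\<bar>\<dots>\<bar> \<le> (\<integral>p. \<bar>T p - T0 p - \<tau> * (\<Sum>e\<in>E. L e p)\<bar> \<partial>unit_cube V)"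
    using integral_norm_bound[of "unit_cube V" "\<lambda>p. T p - T0 p - \<tau> * (\<Sum>e\<in>E. L e p)"] by simp
  also have "\<dots> \<le> (real (card E))\<^sup>2 * \<tau>\<^sup>2"
    using int_diff pointwise by (intro V.integral_le_const) auto
  finally show ?thesis by (simp add: E_def)
qed

section \<open>Convexity of the entropy and the first-order condition\<close>

text \<open>The tangent is taken at the intermediate point \<open>x\<close>. It is positive unless
  both weighted terms vanish, so \<open>w\<close> and \<open>p\<close> may be 0 although
  \<open>x ln x\<close> has no finite slope there.\<close>

lemma mult_ln_convex:
  fixes w p \<tau> :: real
  assumes "0 \<le> w" "0 \<le> p" "\<tau> \<in> {0..1}"
  defines "x \<equiv> w + \<tau> * (p - w)"
  shows "x * ln x \<le> w * ln w + \<tau> * (p * ln p - w * ln w)"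
proof -
  have x: "x = (1 - \<tau>) * w + \<tau> * p" by (simp add: x_def algebra_simps)
  have nn: "0 \<le> (1 - \<tau>) * w" "0 \<le> \<tau> * p" using assms by auto
  have "x * ln x \<le> (1 - \<tau>) * (w * ln w) + \<tau> * (p * ln p)"
  proof (cases "x = 0")
    case True
    hence "(1 - \<tau>) * w = 0" "\<tau> * p = 0" using nn x by linarith+
    thus ?thesis using True by auto
  next
    case False
    hence "x > 0" using nn x by linarith
    hence "(1 - \<tau>) * ((1 + ln x) * w - x) \<le> (1 - \<tau>) * (w * ln w)"
      "\<tau> * ((1 + ln x) * p - x) \<le> \<tau> * (p * ln p)"
      using mult_ln_ge_tangent[of w "1 + ln x"] mult_ln_ge_tangent[of p "1 + ln x"] assms
      by (auto intro!: mult_left_mono)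
    \<comment> \<open>The tangent is affine and touches the graph at \<open>x\<close>, so averaging
      its values at \<open>w\<close> and \<open>p\<close> returns \<open>x ln x\<close>.\<close>
    moreover have "x * ln x = (1 - \<tau>) * ((1 + ln x) * w - x) + \<tau> * ((1 + ln x) * p - x)"
    proof -
      have "(1 - \<tau>) * ((1 + ln x) * w - x) + \<tau> * ((1 + ln x) * p - x)
          = (1 + ln x) * ((1 - \<tau>) * w + \<tau> * p) - x" by (simp add: algebra_simps)
      also have "\<dots> = (1 + ln x) * x - x" by (simp only: x[symmetric])
      finally show ?thesis by (simp add: algebra_simps)
    qed
    ultimately show ?thesis by linarith
  qed
  thus ?thesis by (simp add: algebra_simps)
qed

text \<open>Equality in \<open>ln t \<le> t - 1\<close> forces \<open>t = 1\<close>, here with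
  \<open>t = p / w\<close>; and \<open>w = 0\<close> would force \<open>p = 0\<close>.\<close>

lemma mult_ln_eq_tangent:
  fixes w p :: real
  assumes "0 \<le> w" "0 < p" "w * ln w = w * (1 + ln p) - p"
  shows "w = p"
proof (cases "w = 0")
  case False
  hence w: "w > 0" using assms by simp
  have "ln (p / w) = p / w - 1"
    using assms w by (simp add: ln_div field_simps)
  hence "p / w = 1" using w assms(2) by (intro ln_eq_minus_one) auto
  thus ?thesis using w by simp
qed (use assms in simp)

lemma convex_combination_graphon:
  assumes W: "W \<in> graphons k" and P: "P \<in> graphons k" and \<tau>: "\<tau> \<in> {0..1}"
  shows "(\<lambda>a z. W a z + \<tau> * (P a z - W a z)) \<in> graphons k"
  unfolding graphons_def
proof (intro CollectI conjI ballI)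
  fix a assume a: "a \<in> {1..k}"
  show "(\<lambda>z. W a z + \<tau> * (P a z - W a z)) \<in> borel_measurable unit_square"
    using measurable_graphon[OF W a] measurable_graphon[OF P a] by measurable
  fix x y :: real assume xy: "x \<in> {0..1}" "y \<in> {0..1}"
  hence z: "(x, y) \<in> space unit_square" by (simp add: space_unit_square)
  show "W a (x, y) + \<tau> * (P a (x, y) - W a (x, y)) = W a (y, x) + \<tau> * (P a (y, x) - W a (y, x))"
    using graphon_sym[OF W a z] graphon_sym[OF P a z] by simp
next
  fix x y :: real assume xy: "x \<in> {0..1}" "y \<in> {0..1}"
  hence z: "(x, y) \<in> space unit_square" by (simp add: space_unit_square)
  fix a assume a: "a \<in> {1..k}"
  have r: "W a (x, y) \<in> {0..1}" "P a (x, y) \<in> {0..1}"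
    using graphon_range[OF W a z] graphon_range[OF P a z] .
  have "W a (x, y) + \<tau> * (P a (x, y) - W a (x, y)) = (1 - \<tau>) * W a (x, y) + \<tau> * P a (x, y)"
    by (simp add: algebra_simps)
  moreover have "0 \<le> (1 - \<tau>) * W a (x, y) + \<tau> * P a (x, y)" using r \<tau> by simp
  moreover have "(1 - \<tau>) * W a (x, y) + \<tau> * P a (x, y) \<le> 1"
    using r \<tau> by (intro convex_bound_le) auto
  ultimately show "W a (x, y) + \<tau> * (P a (x, y) - W a (x, y)) \<in> {0..1}" by simp
next
  fix x y :: real assume xy: "x \<in> {0..1}" "y \<in> {0..1}"
  hence z: "(x, y) \<in> space unit_square" by (simp add: space_unit_square)
  show "(\<Sum>a=1..k. W a (x, y) + \<tau> * (P a (x, y) - W a (x, y))) = 1"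
    using graphon_sum[OF W z] graphon_sum[OF P z]
    by (simp add: sum.distrib sum_subtractf flip: sum_distrib_left)
qed

lemma integrable_graphon_entropy:
  assumes "W \<in> graphons k" "a \<in> {1..k}"
  shows "integrable unit_square (\<lambda>z. W a z * ln (W a z))"
  by (rule integrable_mult_ln[OF measurable_graphon[OF assms] graphon_range[OF assms]])

lemma entropy_functional_convex:
  assumes W: "W \<in> graphons k" and P: "P \<in> graphons k" and \<tau>: "\<tau> \<in> {0..1}"
  shows "entropy_functional k (\<lambda>a z. W a z + \<tau> * (P a z - W a z))
    \<le> entropy_functional k W + \<tau> * (entropy_functional k P - entropy_functional k W)"
proof -
  let ?h = "\<lambda>x :: real. x * ln x"
  have "(\<integral>z. ?h (W a z + \<tau> * (P a z - W a z)) \<partial>unit_square)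
      \<le> (\<integral>z. ?h (W a z) \<partial>unit_square)
        + \<tau> * ((\<integral>z. ?h (P a z) \<partial>unit_square) - (\<integral>z. ?h (W a z) \<partial>unit_square))"
    if a: "a \<in> {1..k}" for a
  proof -
    note int = integrable_graphon_entropy[OF W a] integrable_graphon_entropy[OF P a]
      integrable_graphon_entropy[OF convex_combination_graphon[OF assms] a]
    have "(\<integral>z. ?h (W a z + \<tau> * (P a z - W a z)) \<partial>unit_square)
        \<le> (\<integral>z. ?h (W a z) + \<tau> * (?h (P a z) - ?h (W a z)) \<partial>unit_square)"
    proof (rule integral_mono[OF int(3)])
      show "integrable unit_square (\<lambda>z. ?h (W a z) + \<tau> * (?h (P a z) - ?h (W a z)))"
        using int(1,2) by auto
      fix z assume z: "z \<in> space unit_square"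
      show "?h (W a z + \<tau> * (P a z - W a z)) \<le> ?h (W a z) + \<tau> * (?h (P a z) - ?h (W a z))"
        using graphon_range[OF W a z] graphon_range[OF P a z] \<tau> by (intro mult_ln_convex) auto
    qed
    also have "\<dots> = (\<integral>z. ?h (W a z) \<partial>unit_square)
        + \<tau> * ((\<integral>z. ?h (P a z) \<partial>unit_square) - (\<integral>z. ?h (W a z) \<partial>unit_square))"
      using int(1,2) by simp
    finally show ?thesis .
  qed
  from sum_mono[of "{1..k}", OF this] show ?thesis
    by (simp add: entropy_functional_def sum.distrib sum_subtractf flip: sum_distrib_left)
qed

text \<open>The symmetrised derivative of the density part of the free energy in the direction of
  colour \<open>a\<close>.\<close>

definition local_field ::
  "nat \<Rightarrow> (nat \<Rightarrow> real) \<Rightarrow> (nat \<Rightarrow> 'v colored_graph) \<Rightarrow> (nat \<Rightarrow> real \<times> real \<Rightarrow> real) \<Rightarrow>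
     nat \<Rightarrow> real \<times> real \<Rightarrow> real" where
  "local_field r \<beta> H W a z = (\<Sum>s=1..r. \<beta> s * sym_edge_delta (H s) a W z)"

text \<open>One-sided variation along the segment from \<open>W\<close> to \<open>P\<close>.
  Convexity replaces the entropy by its chord, which is linear in \<tau>, so only the densities
  leave a quadratic error; dividing by \<tau> removes it in the limit.\<close>

lemma first_order_condition:
  assumes H: "\<And>s. s \<in> {1..r} \<Longrightarrow> simple_colored_graph k (H s)"
    and W: "W \<in> graphons k" and P: "P \<in> graphons k"
    and max: "\<And>V. V \<in> graphons k \<Longrightarrow> free_energy k r \<beta> H V \<le> free_energy k r \<beta> H W"
  shows "(\<Sum>a=1..k. \<integral>z. (P a z - W a z) * local_field r \<beta> H W a z \<partial>unit_square)
    \<le> 1 / 2 * (entropy_functional k P - entropy_functional k W)"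
proof -
  define D where "D a z = P a z - W a z" for a z
  define slope where "slope s = (\<Sum>a=1..k. \<integral>z. D a z * edge_delta (H s) a W z \<partial>unit_square)" for s
  \<comment> \<open>The sum of the remainder constants of \<open>hom_density_expansion\<close>,
    weighted by the couplings.\<close>
  define C where "C = (\<Sum>s=1..r. \<bar>\<beta> s\<bar> * (real (card (edges (H s))))\<^sup>2)"
  define gap where "gap = (\<Sum>s=1..r. \<beta> s * slope s)
    - 1 / 2 * (entropy_functional k P - entropy_functional k W)"
  have le: "gap \<le> C * \<tau>" if \<tau>: "0 < \<tau>" "\<tau> \<le> 1" for \<tau>
  proof -
    define V where "V = (\<lambda>a z. W a z + \<tau> * (P a z - W a z))"
    have \<tau>': "\<tau> \<in> {0..1}" using \<tau> by simp
    have "\<beta> s * (hom_density (H s) V - hom_density (H s) W)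
        \<ge> \<tau> * (\<beta> s * slope s) - \<bar>\<beta> s\<bar> * (real (card (edges (H s))))\<^sup>2 * \<tau>\<^sup>2" if s: "s \<in> {1..r}" for s
    proof -
      have "\<bar>\<beta> s\<bar> * \<bar>hom_density (H s) V - hom_density (H s) W - \<tau> * slope s\<bar>
          \<le> \<bar>\<beta> s\<bar> * ((real (card (edges (H s))))\<^sup>2 * \<tau>\<^sup>2)"
        using hom_density_expansion[OF H[OF s] W P \<tau>'] unfolding V_def slope_def D_def
        by (intro mult_left_mono) auto
      hence "\<bar>\<beta> s * (hom_density (H s) V - hom_density (H s) W - \<tau> * slope s)\<bar>
          \<le> \<bar>\<beta> s\<bar> * (real (card (edges (H s))))\<^sup>2 * \<tau>\<^sup>2"
        by (simp add: abs_mult mult.assoc)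
      hence "- (\<bar>\<beta> s\<bar> * (real (card (edges (H s))))\<^sup>2 * \<tau>\<^sup>2)
          \<le> \<beta> s * (hom_density (H s) V - hom_density (H s) W - \<tau> * slope s)"
        by (simp only: abs_le_iff minus_le_iff)
      thus ?thesis by (simp add: algebra_simps)
    qed
    from sum_mono[of "{1..r}", OF this]
    have dens: "\<tau> * (\<Sum>s=1..r. \<beta> s * slope s) - C * \<tau>\<^sup>2
        \<le> (\<Sum>s=1..r. \<beta> s * hom_density (H s) V) - (\<Sum>s=1..r. \<beta> s * hom_density (H s) W)"
      by (simp add: C_def sum_subtractf sum_distrib_left sum_distrib_right right_diff_distrib)
    have "free_energy k r \<beta> H V \<le> free_energy k r \<beta> H W"
      unfolding V_def by (intro max convex_combination_graphon W P \<tau>')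
    moreover have "entropy_functional k V
        \<le> entropy_functional k W + \<tau> * (entropy_functional k P - entropy_functional k W)"
      unfolding V_def by (rule entropy_functional_convex[OF W P \<tau>'])
    ultimately have "\<tau> * gap \<le> C * \<tau>\<^sup>2"
      using dens unfolding free_energy_def gap_def right_diff_distrib by linarith
    thus ?thesis using \<tau>(1) by (simp add: power2_eq_square mult.left_commute)
  qed
  \<comment> \<open>The step sizes \<open>1 / real (Suc n)\<close> lie in the admissible range from
    the start.\<close>
  have "(\<lambda>n. C * (1 / real (Suc n))) \<longlonglongrightarrow> C * 0"
    by (intro tendsto_mult tendsto_const LIMSEQ_Suc lim_1_over_n)
  moreover have "gap \<le> C * (1 / real (Suc n))" for n by (rule le) auto
  ultimately have "gap \<le> 0" by (intro LIMSEQ_le_const[of _ 0]) auto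
  \<comment> \<open>The directions \<open>D a\<close> are symmetric, so the kernels may be replaced
    by their symmetrisations, which is what \<open>local_field\<close> is built from.\<close>
  moreover have "(\<Sum>s=1..r. \<beta> s * slope s)
      = (\<Sum>a=1..k. \<integral>z. D a z * local_field r \<beta> H W a z \<partial>unit_square)"
  proof -
    have "(\<integral>z. D a z * local_field r \<beta> H W a z \<partial>unit_square)
        = (\<Sum>s=1..r. \<beta> s * (\<integral>z. D a z * edge_delta (H s) a W z \<partial>unit_square))" if a: "a \<in> {1..k}" for a
    proof -
      have meas: "D a \<in> borel_measurable unit_square"
        unfolding D_def using measurable_graphon[OF W a] measurable_graphon[OF P a] by measurable
      have le: "\<bar>D a z\<bar> \<le> 1" if "z \<in> space unit_square" for z
        using graphon_range[OF W a that] graphon_range[OF P a that] by (auto simp: D_def)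
      have sym: "D a (prod.swap z) = D a z" if "z \<in> space unit_square" for z
        using graphon_sym[OF W a, of "fst z" "snd z"] graphon_sym[OF P a, of "fst z" "snd z"] that
        by (simp add: D_def prod.swap_def)
      have "(\<integral>z. D a z * local_field r \<beta> H W a z \<partial>unit_square)
          = (\<integral>z. (\<Sum>s=1..r. \<beta> s * (D a z * sym_edge_delta (H s) a W z)) \<partial>unit_square)"
        by (simp only: local_field_def sum_distrib_left mult.left_commute)
      also have "\<dots> = (\<Sum>s=1..r. \<integral>z. \<beta> s * (D a z * sym_edge_delta (H s) a W z) \<partial>unit_square)"
        by (intro Bochner_Integration.integral_sum integrable_mult_right
            integrable_times_bounded[OF meas le measurable_sym_edge_delta[OF H W]
              abs_sym_edge_delta_le[OF H W]])
      also have "\<dots> = (\<Sum>s=1..r. \<beta> s * (\<integral>z. D a z * edge_delta (H s) a W z \<partial>unit_square))"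
        using integral_sym_edge_delta[OF H W meas le sym, of _ a] by simp
      finally show ?thesis .
    qed
    hence "(\<Sum>a=1..k. \<integral>z. D a z * local_field r \<beta> H W a z \<partial>unit_square)
        = (\<Sum>a=1..k. \<Sum>s=1..r. \<beta> s * (\<integral>z. D a z * edge_delta (H s) a W z \<partial>unit_square))"
      by (intro sum.cong) auto
    also have "\<dots> = (\<Sum>s=1..r. \<beta> s * slope s)"
      unfolding slope_def sum_distrib_left by (rule sum.swap)
    finally show ?thesis ..
  qed
  ultimately show ?thesis by (simp add: gap_def D_def)
qed

lemma
  assumes H: "\<And>s. s \<in> {1..r} \<Longrightarrow> simple_colored_graph k (H s)" and W: "W \<in> graphons k"
  shows measurable_local_field: "local_field r \<beta> H W a \<in> borel_measurable unit_square"
    and abs_local_field_le: "z \<in> space unit_square \<Longrightarrow>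
      \<bar>local_field r \<beta> H W a z\<bar> \<le> (\<Sum>s=1..r. \<bar>\<beta> s\<bar> * real (card (edges (H s))))"
proof -
  show "local_field r \<beta> H W a \<in> borel_measurable unit_square"
    unfolding local_field_def[abs_def]
    by (intro borel_measurable_sum borel_measurable_times borel_measurable_const
        measurable_sym_edge_delta[OF H W])
  assume z: "z \<in> space unit_square"
  show "\<bar>local_field r \<beta> H W a z\<bar> \<le> (\<Sum>s=1..r. \<bar>\<beta> s\<bar> * real (card (edges (H s))))"
    unfolding local_field_def using abs_sym_edge_delta_le[OF H W z, of _ a]
    by (intro order_trans[OF sum_abs] sum_mono) (auto simp: abs_mult intro!: mult_left_mono)
qed

section \<open>The Gibbs density and the conclusion\<close>

text \<open>At each point the maximizer, over probability vectors on the colours, of the mean of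
  \<open>G a z\<close> plus half the Shannon entropy: the Lagrange condition makes
  \<open>G a z - ln (p a) / 2\<close> the same for all colours.\<close>

definition gibbs :: "nat \<Rightarrow> (nat \<Rightarrow> real \<times> real \<Rightarrow> real) \<Rightarrow> nat \<Rightarrow> real \<times> real \<Rightarrow> real" where
  "gibbs k G a z = exp (2 * G a z) / (\<Sum>b=1..k. exp (2 * G b z))"

lemma gibbs_sum:
  assumes "k \<ge> 1"
  shows "(\<Sum>a=1..k. gibbs k G a z) = 1"
proof -
  have "(\<Sum>b=1..k. exp (2 * G b z)) > 0" using assms by (intro sum_pos) auto
  thus ?thesis unfolding gibbs_def sum_divide_distrib[symmetric] by simp
qed

text \<open>The numerator is at least \<open>exp (- 2 * M)\<close>, and each of the \<open>k\<close>
  terms of the denominator is at most \<open>exp (2 * M)\<close>.\<close>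

lemma gibbs_ge:
  assumes "k \<ge> 1" "\<And>b. \<bar>G b z\<bar> \<le> M"
  shows "exp (- 2 * M) / (real k * exp (2 * M)) \<le> gibbs k G a z"
proof -
  have M: "G b z \<le> M" "- M \<le> G b z" for b using assms(2)[of b] by (auto simp: abs_le_iff)
  have "(\<Sum>b=1..k. exp (2 * G b z)) \<le> (\<Sum>b=1..k. exp (2 * M))"
    using M(1) by (intro sum_mono) auto
  moreover have "(\<Sum>b=1..k. exp (2 * G b z)) > 0" using assms(1) by (intro sum_pos) auto
  ultimately show ?thesis
    unfolding gibbs_def using M(2)[of a] by (intro frac_le) auto
qed

lemma gibbs_pos:
  assumes "k \<ge> 1"
  shows "0 < gibbs k G a z"
  unfolding gibbs_def using assms by (intro divide_pos_pos sum_pos) auto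

text \<open>With at least two colours, some other colour already takes \<epsilon> of the total mass
  1.\<close>

lemma gibbs_le:
  assumes "k \<ge> 2" "\<And>b. \<epsilon> \<le> gibbs k G b z" "a \<in> {1..k}"
  shows "gibbs k G a z \<le> 1 - \<epsilon>"
proof -
  obtain b where b: "b \<in> {1..k}" "b \<noteq> a"
  proof (cases "a = 1")
    case True thus ?thesis using assms(1) by (intro that[of 2]) auto
  next
    case False thus ?thesis using assms(1) by (intro that[of 1]) auto
  qed
  have "(\<Sum>c\<in>{a, b}. gibbs k G c z) \<le> (\<Sum>c=1..k. gibbs k G c z)"
    using b assms(3) gibbs_pos[of k G _ z] assms(1)
    by (intro sum_mono2) (auto intro: less_imp_le)
  thus ?thesis using gibbs_sum[of k G z] assms(1) assms(2)[of b] b(2) by auto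
qed

text \<open>The subtracted term is the same for all colours; it will vanish against differences of
  probability vectors.\<close>

lemma ln_gibbs:
  assumes "k \<ge> 1"
  shows "ln (gibbs k G a z) = 2 * G a z - ln (\<Sum>b=1..k. exp (2 * G b z))"
proof -
  have "(\<Sum>b=1..k. exp (2 * G b z)) > 0" using assms by (intro sum_pos) auto
  thus ?thesis unfolding gibbs_def by (simp add: ln_div)
qed

lemma gibbs_graphon:
  assumes k: "k \<ge> 1" and meas: "\<And>a. G a \<in> borel_measurable unit_square"
    and sym: "\<And>a z. G a (prod.swap z) = G a z"
  shows "gibbs k G \<in> graphons k"
  unfolding graphons_def
proof (intro CollectI conjI ballI)
  fix a assume a: "a \<in> {1..k}"
  note [measurable] = meas
  show "gibbs k G a \<in> borel_measurable unit_square" unfolding gibbs_def[abs_def] by measurable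
  fix x y :: real
  show "gibbs k G a (x, y) = gibbs k G a (y, x)" using sym[of _ "(y, x)"] by (simp add: gibbs_def)
next
  fix x y :: real and a assume a: "a \<in> {1..k}"
  have "gibbs k G a (x, y) \<le> (\<Sum>a=1..k. gibbs k G a (x, y))"
    using a gibbs_pos[OF k] by (intro member_le_sum) (auto intro: less_imp_le)
  thus "gibbs k G a (x, y) \<in> {0..1}" using gibbs_sum[OF k] gibbs_pos[OF k, of G a] by (simp add: less_imp_le)
qed (rule gibbs_sum[OF k])

lemma maximizer_eq_gibbs:
  assumes k: "k \<ge> 1" and H: "\<And>s. s \<in> {1..r} \<Longrightarrow> simple_colored_graph k (H s)"
    and W: "W \<in> graphons k"
    and max: "\<And>V. V \<in> graphons k \<Longrightarrow> free_energy k r \<beta> H V \<le> free_energy k r \<beta> H W"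
  shows "AE z in unit_square. \<forall>a\<in>{1..k}. W a z = gibbs k (local_field r \<beta> H W) a z"
proof -
  define G where "G = local_field r \<beta> H W"
  define P where "P = gibbs k G"
  have P: "P \<in> graphons k" unfolding P_def G_def
    using measurable_local_field[OF H W]
    by (intro gibbs_graphon[OF k]) (auto simp: local_field_def sym_edge_delta_swap)
  have P_pos: "0 < P a z" for a z unfolding P_def by (rule gibbs_pos[OF k])
  \<comment> \<open>The distance of \<open>x ln x\<close> at \<open>W a z\<close> above its tangent
    at \<open>P a z\<close>. Summed over the colours it is the relative entropy, because both
    vectors sum to 1; in this form each summand is nonnegative by itself.\<close>
  define kl where "kl a z = W a z * ln (W a z) - (W a z * (1 + ln (P a z)) - P a z)" for a z
  have kl_nonneg: "0 \<le> kl a z" if "a \<in> {1..k}" "z \<in> space unit_square" for a z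
    using mult_ln_ge_tangent[of "W a z" "1 + ln (P a z)"] graphon_range[OF W that] P_pos[of a z]
    by (simp add: kl_def mult.commute)
  have kl_sum: "(\<Sum>a=1..k. kl a z)
      = (\<Sum>a=1..k. W a z * ln (W a z) - P a z * ln (P a z) + 2 * ((P a z - W a z) * G a z))"
    if z: "z \<in> space unit_square" for z
  proof -
    define Z where "Z = ln (\<Sum>b=1..k. exp (2 * G b z))"
    have ln_P: "ln (P a z) = 2 * G a z - Z" for a unfolding P_def Z_def by (rule ln_gibbs[OF k])
    have "kl a z = W a z * ln (W a z) - P a z * ln (P a z) + 2 * ((P a z - W a z) * G a z)
        + (1 - Z) * (P a z - W a z)" for a
      unfolding kl_def ln_P by (simp add: algebra_simps)
    \<comment> \<open>Both vectors have total mass 1, so the normaliser and the affine terms of the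
      tangents cancel.\<close>
    moreover have "(\<Sum>a=1..k. (1 - Z) * (P a z - W a z)) = 0"
      using graphon_sum[OF W z] graphon_sum[OF P z]
      by (simp add: sum_subtractf flip: sum_distrib_left)
    ultimately show ?thesis by (simp add: sum.distrib)
  qed
  have int: "integrable unit_square (\<lambda>z. W a z * ln (W a z))"
    "integrable unit_square (\<lambda>z. P a z * ln (P a z))"
    "integrable unit_square (\<lambda>z. (P a z - W a z) * G a z)" if a: "a \<in> {1..k}" for a
  proof -
    show "integrable unit_square (\<lambda>z. W a z * ln (W a z))"
      "integrable unit_square (\<lambda>z. P a z * ln (P a z))"
      using integrable_graphon_entropy[OF W a] integrable_graphon_entropy[OF P a] .
    have "(\<lambda>z. P a z - W a z) \<in> borel_measurable unit_square"
      using measurable_graphon[OF W a] measurable_graphon[OF P a] by measurable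
    moreover have "\<bar>P a z - W a z\<bar> \<le> 1" if "z \<in> space unit_square" for z
      using graphon_range[OF W a that] graphon_range[OF P a that] by auto
    ultimately show "integrable unit_square (\<lambda>z. (P a z - W a z) * G a z)"
      unfolding G_def
      by (rule integrable_times_bounded[OF _ _ measurable_local_field[OF H W]
            abs_local_field_le[OF H W]])
  qed
  have int_kl: "integrable unit_square (\<lambda>z. \<Sum>a=1..k. kl a z)"
  proof (subst Bochner_Integration.integrable_cong[OF refl kl_sum])
    show "integrable unit_square (\<lambda>z. \<Sum>a=1..k.
        W a z * ln (W a z) - P a z * ln (P a z) + 2 * ((P a z - W a z) * G a z))"
      using int by auto
  qed
  have "(\<integral>z. (\<Sum>a=1..k. kl a z) \<partial>unit_square) = (\<integral>z. (\<Sum>a=1..k.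
      W a z * ln (W a z) - P a z * ln (P a z) + 2 * ((P a z - W a z) * G a z)) \<partial>unit_square)"
    by (rule Bochner_Integration.integral_cong[OF refl kl_sum])
  also have "\<dots> = (\<Sum>a=1..k. (\<integral>z. W a z * ln (W a z) \<partial>unit_square)
      - (\<integral>z. P a z * ln (P a z) \<partial>unit_square) + 2 * (\<integral>z. (P a z - W a z) * G a z \<partial>unit_square))"
    using int by (subst Bochner_Integration.integral_sum) (auto intro!: sum.cong)
  also have "\<dots> = entropy_functional k W - entropy_functional k P
      + 2 * (\<Sum>a=1..k. \<integral>z. (P a z - W a z) * G a z \<partial>unit_square)"
    by (simp add: entropy_functional_def sum.distrib sum_subtractf sum_distrib_left)
  \<comment> \<open>Twice the first-order condition for the competitor \<open>P\<close>, which is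
    itself built from \<open>W\<close>.\<close>
  also have "\<dots> \<le> 0"
    using first_order_condition[OF H W P max] unfolding G_def by simp
  finally have "(\<integral>z. (\<Sum>a=1..k. kl a z) \<partial>unit_square) = 0"
    using kl_nonneg by (intro antisym integral_nonneg_AE AE_I2 sum_nonneg) auto
  moreover have "AE z in unit_square. 0 \<le> (\<Sum>a=1..k. kl a z)"
    by (intro AE_I2 sum_nonneg kl_nonneg)
  ultimately have "AE z in unit_square. (\<Sum>a=1..k. kl a z) = 0"
    using integral_nonneg_eq_0_iff_AE[OF int_kl] by simp
  thus ?thesis
  proof (rule AE_mp, intro AE_I2 impI ballI)
    fix z a assume z: "z \<in> space unit_square" and zero: "(\<Sum>a=1..k. kl a z) = 0"
      and a: "a \<in> {1..k}"
    have "\<forall>a\<in>{1..k}. kl a z = 0"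
      using zero by (rule iffD1[OF sum_nonneg_eq_0_iff, rotated 2]) (auto intro: kl_nonneg z)
    hence "kl a z = 0" using a by (rule bspec)
    hence "W a z * ln (W a z) = W a z * (1 + ln (P a z)) - P a z"
      unfolding kl_def by (simp only: right_minus_eq)
    moreover have "0 \<le> W a z" using graphon_range[OF W a z] by simp
    ultimately have "W a z = P a z" using P_pos[of a z] mult_ln_eq_tangent by blast
    thus "W a z = gibbs k (local_field r \<beta> H W) a z" by (simp add: P_def G_def)
  qed
qed

theorem theorem3p18:
  fixes k r :: nat
    and \<beta> :: "nat \<Rightarrow> real"
    and H :: "nat \<Rightarrow> 'v colored_graph"
    and C :: "(nat \<Rightarrow> real \<times> real \<Rightarrow> real) set"
    and W :: "nat \<Rightarrow> real \<times> real \<Rightarrow> real"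
  assumes "k \<ge> 2"
    and "\<And>s. s \<in> {1..r} \<Longrightarrow> simple_colored_graph k (H s)"
    and "is_arg_max (free_energy_class k r \<beta> H) (\<lambda>D. D \<in> graphon_classes k) C"
    and "W \<in> C"
  shows "(\<forall>a\<in>{1..k}. AE z in unit_square.
            W a z = exp (2 * (\<Sum>s=1..r. \<beta> s * sym_edge_delta (H s) a W z)) /
              (\<Sum>b=1..k. exp (2 * (\<Sum>s=1..r. \<beta> s * sym_edge_delta (H s) b W z)))) \<and>
         (\<exists>\<epsilon>>0. \<forall>a\<in>{1..k}. AE z in unit_square. \<epsilon> \<le> W a z \<and> W a z \<le> 1 - \<epsilon>)"
proof -
  have W: "W \<in> graphons k"
    using maximizing_class_representative(1)[OF assms(2-4)] by simp
  have max: "free_energy k r \<beta> H V \<le> free_energy k r \<beta> H W" if "V \<in> graphons k" for V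
    using maximizing_class_representative(2)[OF assms(2-4) that] by simp
  have k: "k \<ge> 1" using assms(1) by simp
  let ?G = "local_field r \<beta> H W"
  have eq: "AE z in unit_square. \<forall>a\<in>{1..k}. W a z = gibbs k ?G a z"
    by (rule maximizer_eq_gibbs[OF k assms(2) W max])
  \<comment> \<open>A bound on the local field uniform in the point and the colour, as each edge
    marginal has modulus at most 1; \<epsilon> is the resulting lower bound on Gibbs
    weights.\<close>
  define M where "M = (\<Sum>s=1..r. \<bar>\<beta> s\<bar> * real (card (edges (H s))))"
  define \<epsilon> where "\<epsilon> = exp (- 2 * M) / (real k * exp (2 * M))"
  have ge: "\<epsilon> \<le> gibbs k ?G a z" if "z \<in> space unit_square" for a z
    unfolding \<epsilon>_def M_def
    by (rule gibbs_ge[OF k], rule abs_local_field_le[OF assms(2) W that])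
  show ?thesis
  proof (intro conjI ballI exI[of _ \<epsilon>])
    show "\<epsilon> > 0" using k by (simp add: \<epsilon>_def)
  next
    fix a assume a: "a \<in> {1..k}"
    show "AE z in unit_square. W a z = exp (2 * (\<Sum>s=1..r. \<beta> s * sym_edge_delta (H s) a W z)) /
        (\<Sum>b=1..k. exp (2 * (\<Sum>s=1..r. \<beta> s * sym_edge_delta (H s) b W z)))"
      using eq by eventually_elim (use a in \<open>simp add: gibbs_def local_field_def\<close>)
    show "AE z in unit_square. \<epsilon> \<le> W a z \<and> W a z \<le> 1 - \<epsilon>"
      using eq
    proof (rule AE_mp, intro AE_I2 impI)
      fix z assume z: "z \<in> space unit_square" and "\<forall>a\<in>{1..k}. W a z = gibbs k ?G a z"
      thus "\<epsilon> \<le> W a z \<and> W a z \<le> 1 - \<epsilon>"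
        using a ge[OF z] gibbs_le[OF assms(1) ge[OF z] a] by simp
    qed
  qed
qed

end
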